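(* Let $\lambda\ge1$ and let $\mathcal P$ be a strongly $\lambda$-bounded sequential selection process with ground set $U$ of $n$ elements, input vector $\mathbf{x}\in[0,1]^n$ and output $\mathbf{X}\in\{0,1\}^n$. Let $a_1,\dots,a_n\in[0,1]$ be arbitrary and $\mathbf{a}=(a_1,\dots,a_n)$. Then for all $\delta\in(0,1/5)$, $$\Pr\left[\mathbf{a}\cdot\mathbf{X}\le\left(\frac15-\delta\right)\frac{\mathbf{a}\cdot\mathbf{x}}{\lambda+1}\right]\le 4\exp\left(-\frac{\delta^2(\mathbf{a}\cdot\mathbf{x})}{3(\lambda+1)^3}\right).$$
   Context: A sequential selection process is a random process of the following form. Input: a ground set $U$ of $n$ elements and a vector $\mathbf{x}\in[0,1]^n$ indexed by $U$. The process maintains a vector $\mathbf{p}$, with initial value $\mathbf{p}(1)=\mathbf{x}$, and a vector $\mathbf{X}\in\{0,1\}^n$, initially zero. It generates a uniformly random ordering $\sigma$ of $U$ and a random set $R\subseteq U$ containing each $e$ independently with probability $x_e$, revealed step by step: at time step $t=1,\dots,n$ it chooses a uniformly random element $e\notin\{\sigma(1),\dots,\sigma(t-1)\}$, sets $\sigma(t)=e$, and includes $e$ in $R$ independently with probability $x_e$. Then: (i) if $e\notin R$, $X_e=0$; if $e\in R$, $X_e$ is set to $1$ with some arbitrary probability (possibly depending on past events) that is at least $p_e(t)/x_e$, and to $0$ otherwise; (ii) a vector $\mathbf{\Delta}(t)\in[0,1]^n$ with $0\le\Delta_{e'}(t)\le p_{e'}(t)$ for all $e'\in U$ is generated arbitrarily,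 and $\mathbf{p}(t+1)=\mathbf{p}(t)-\mathbf{\Delta}(t)$. The output is the final $\mathbf{X}$. Let $\mathcal F_{t-1}$ denote the state (history) of the process after completion of time step $t-1$. The process is $\lambda$-bounded if $\mathbb{E}[\Delta_e(t)\mid\mathcal F_{t-1}]\le\frac{\lambda x_e}{n-t+1}$ for all $e\in U$ and $t\in[n]$; it is $\lambda$-limited if always $\|\mathbf{\Delta}(t)\|_1\le\lambda$ for all $t$; it is strongly $\lambda$-bounded if it is both $\lambda$-bounded and $\lambda$-limited. *)

theory Defs
  imports "HOL-Probability.Probability"
begin

text \<open>The history \<open>G\<close> enriched by the value of a discrete random variable \<open>f\<close>.\<close>

definition reveal :: "'w measure \<Rightarrow> ('w \<Rightarrow> 'b) \<Rightarrow> 'w measure" where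
  "reveal G f = sigma (space G) (sets G \<union> {f -` S \<inter> space G |S. True})"

definition cond_pr :: "'w measure \<Rightarrow> 'w measure \<Rightarrow> ('w \<Rightarrow> bool) \<Rightarrow> 'w \<Rightarrow> real" where
  "cond_pr M G P = real_cond_exp M G (indicat_real {\<omega> \<in> space M. P \<omega>})"

text \<open>
  All random objects live on one probability space \<open>M\<close>. The \<open>\<sigma>\<close>-algebra \<open>F t\<close> is the history
  after completion of time step \<open>t\<close>; it makes everything produced up to step \<open>t\<close> measurable, and
  may in addition contain whatever internal state and auxiliary randomness the arbitrary choices
  of the process depend on. \<open>X t\<close> is the vector \<open>X\<close> after completion of step \<open>t\<close>, so the output
  is \<open>X (card U)\<close>, whereas \<open>p t\<close> is the vector \<open>p\<close> at the start of step \<open>t\<close>. Of the values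
  \<open>\<sigma> t\<close>, \<open>\<Delta> t\<close> only those for \<open>1 \<le> t \<le> card U\<close> matter.

  Within step \<open>t\<close>, the element \<open>\<sigma> t\<close> is drawn given \<open>F (t - 1)\<close>, its membership in \<open>R\<close> is drawn
  given also \<open>\<sigma> t\<close>, and its entry of \<open>X\<close> given also that membership; \<open>\<Delta> t\<close> may depend on all of
  these. In \<open>X_prob\<close> the case \<open>x (\<sigma> t \<omega>) = 0\<close> is immaterial, because \<open>\<sigma> t \<omega> \<in> R \<omega>\<close> then has
  probability zero.
\<close>

locale sequential_selection_process =
  prob_space M + filtration "space M" F
  for M :: "'w measure" and F :: "nat \<Rightarrow> 'w measure" +
  fixes U :: "'e set"
    and x :: "'e \<Rightarrow> real"
    and \<sigma> :: "nat \<Rightarrow> 'w \<Rightarrow> 'e"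
    and R :: "'w \<Rightarrow> 'e set"
    and X :: "nat \<Rightarrow> 'e \<Rightarrow> 'w \<Rightarrow> real"
    and p :: "nat \<Rightarrow> 'e \<Rightarrow> 'w \<Rightarrow> real"
    and \<Delta> :: "nat \<Rightarrow> 'e \<Rightarrow> 'w \<Rightarrow> real"
  assumes finite_U: "finite U"
    and x_range: "\<And>e. e \<in> U \<Longrightarrow> x e \<in> {0..1}"
    and subalgebra_F: "\<And>t. subalgebra M (F t)"
    and adapted_\<sigma>: "\<And>t. t \<in> {1..card U} \<Longrightarrow> \<sigma> t \<in> measurable (F t) (count_space U)"
    and adapted_R: "\<And>t. t \<in> {1..card U} \<Longrightarrow> Measurable.pred (F t) (\<lambda>\<omega>. \<sigma> t \<omega> \<in> R \<omega>)"
    and adapted_X: "\<And>t e. t \<in> {1..card U} \<Longrightarrow> e \<in> U \<Longrightarrow> X t e \<in> borel_measurable (F t)"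
    and adapted_\<Delta>: "\<And>t e. t \<in> {1..card U} \<Longrightarrow> e \<in> U \<Longrightarrow> \<Delta> t e \<in> borel_measurable (F t)"
    and \<sigma>_new: "\<And>t \<omega>. t \<in> {1..card U} \<Longrightarrow> \<omega> \<in> space M \<Longrightarrow>
      \<sigma> t \<omega> \<in> U - (\<lambda>s. \<sigma> s \<omega>) ` {1..<t}"
    and \<sigma>_uniform: "\<And>t e. t \<in> {1..card U} \<Longrightarrow> e \<in> U \<Longrightarrow>
      AE \<omega> in M. e \<notin> (\<lambda>s. \<sigma> s \<omega>) ` {1..<t} \<longrightarrow>
        cond_pr M (F (t - 1)) (\<lambda>\<omega>'. \<sigma> t \<omega>' = e) \<omega> = 1 / (real (card U) - real t + 1)"
    and R_subset: "\<And>\<omega>. \<omega> \<in> space M \<Longrightarrow> R \<omega> \<subseteq> U"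
    and R_prob: "\<And>t. t \<in> {1..card U} \<Longrightarrow>
      AE \<omega> in M. cond_pr M (reveal (F (t - 1)) (\<sigma> t)) (\<lambda>\<omega>'. \<sigma> t \<omega>' \<in> R \<omega>') \<omega> = x (\<sigma> t \<omega>)"
    and X_init: "\<And>e \<omega>. e \<in> U \<Longrightarrow> \<omega> \<in> space M \<Longrightarrow> X 0 e \<omega> = 0"
    and X_other: "\<And>t e \<omega>. t \<in> {1..card U} \<Longrightarrow> e \<in> U \<Longrightarrow> \<omega> \<in> space M \<Longrightarrow> e \<noteq> \<sigma> t \<omega> \<Longrightarrow>
      X t e \<omega> = X (t - 1) e \<omega>"
    and X_range: "\<And>t \<omega>. t \<in> {1..card U} \<Longrightarrow> \<omega> \<in> space M \<Longrightarrow> X t (\<sigma> t \<omega>) \<omega> \<in> {0, 1}"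
    and X_outside_R: "\<And>t \<omega>. t \<in> {1..card U} \<Longrightarrow> \<omega> \<in> space M \<Longrightarrow> \<sigma> t \<omega> \<notin> R \<omega> \<Longrightarrow>
      X t (\<sigma> t \<omega>) \<omega> = 0"
    and X_prob: "\<And>t. t \<in> {1..card U} \<Longrightarrow>
      AE \<omega> in M. \<sigma> t \<omega> \<in> R \<omega> \<longrightarrow>
        cond_pr M (reveal (F (t - 1)) (\<lambda>\<omega>'. (\<sigma> t \<omega>', \<sigma> t \<omega>' \<in> R \<omega>')))
          (\<lambda>\<omega>'. X t (\<sigma> t \<omega>') \<omega>' = 1) \<omega>
        \<ge> p t (\<sigma> t \<omega>) \<omega> / x (\<sigma> t \<omega>)"
    and p_init: "\<And>e \<omega>. e \<in> U \<Longrightarrow> \<omega> \<in> space M \<Longrightarrow> p 1 e \<omega> = x e"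
    and p_step: "\<And>t e \<omega>. t \<in> {1..card U} \<Longrightarrow> e \<in> U \<Longrightarrow> \<omega> \<in> space M \<Longrightarrow>
      p (t + 1) e \<omega> = p t e \<omega> - \<Delta> t e \<omega>"
    and \<Delta>_range: "\<And>t e \<omega>. t \<in> {1..card U} \<Longrightarrow> e \<in> U \<Longrightarrow> \<omega> \<in> space M \<Longrightarrow> \<Delta> t e \<omega> \<in> {0..1}"
    and \<Delta>_le_p: "\<And>t e \<omega>. t \<in> {1..card U} \<Longrightarrow> e \<in> U \<Longrightarrow> \<omega> \<in> space M \<Longrightarrow> \<Delta> t e \<omega> \<le> p t e \<omega>"

locale bounded_sequential_selection_process = sequential_selection_process +
  fixes lam :: real
  assumes bounded: "\<And>t e. t \<in> {1..card U} \<Longrightarrow> e \<in> U \<Longrightarrow>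
    AE \<omega> in M. real_cond_exp M (F (t - 1)) (\<Delta> t e) \<omega> \<le> lam * x e / (real (card U) - real t + 1)"

locale limited_sequential_selection_process = sequential_selection_process +
  fixes lam :: real
  assumes limited: "\<And>t \<omega>. t \<in> {1..card U} \<Longrightarrow> \<omega> \<in> space M \<Longrightarrow> (\<Sum>e\<in>U. \<bar>\<Delta> t e \<omega>\<bar>) \<le> lam"

locale strongly_bounded_sequential_selection_process =
  bounded_sequential_selection_process M F U x \<sigma> R X p \<Delta> lam +
  limited_sequential_selection_process M F U x \<sigma> R X p \<Delta> lam
  for M :: "'w measure" and F :: "nat \<Rightarrow> 'w measure" and U :: "'e set" and x \<sigma> R X p \<Delta> lam

end

theory Submission
  imports Defs
begin

text \<open>
  While the elements arrive, let \<open>A\<close> be the weight \<open>a \<cdot> X\<close> collected so far, and let \<open>Y\<close> and \<open>Z\<close> be the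
  sums of \<open>a e * p e\<close> and \<open>a e * x e\<close> over the elements that have not arrived yet. In a step at whose
  start \<open>m\<close> elements are left, \<open>A\<close> grows by at least \<open>Y / m\<close> in conditional mean, \<open>Y\<close> drops by at most
  \<open>(Y + lam * Z) / m\<close>, and \<open>Z\<close> drops by \<open>Z / m\<close>. As this is linear, for \<open>k \<approx> n / (2 * lam)\<close> and
  \<open>\<kappa> = lam * k / n \<approx> 1/2\<close> the combination \<open>G = A + c * (Y - \<kappa> * Z)\<close>, with coefficient
  \<open>c = (k - t) / (n - t)\<close> after \<open>t\<close> steps, is a submartingale up to time \<open>k\<close>. It starts at
  \<open>k / n * (1 - \<kappa>) * (a \<cdot> x) \<ge> (a \<cdot> x) / (5 * lam)\<close> and equals \<open>A\<close> at time \<open>k\<close>. Its increments are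
  bounded and their mean absolute value is of order \<open>Z / m \<le> (a \<cdot> x) / m\<close>, so \<open>exp (- \<theta> * G)\<close> grows in
  mean by at most a factor \<open>exp (6 * \<theta>\<^sup>2 * (a \<cdot> x) / m)\<close> per step, and Markov's inequality with
  \<open>\<theta> = \<delta> / 12\<close> gives the claim. Rounding \<open>k\<close> to an integer is harmless, because the asserted bound exceeds
  \<open>1\<close> unless \<open>n\<close> is much larger than \<open>lam\<close>.
\<close>

section \<open>An exponential inequality; conditional probabilities and enriched histories\<close>

lemma exp_minus_le_quadratic:
  fixes y :: real
  assumes "\<bar>y\<bar> \<le> 1"
  shows "exp (- y) \<le> 1 - y + y\<^sup>2"
proof (cases "y \<le> 0")
  case True
  then show ?thesis using exp_bound[of "-y"] assms by simp
next
  case False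
  \<comment> \<open>The product on the right equals \<open>1 + y ^ 3\<close>.\<close>
  have "1 \<le> (1 - y + y\<^sup>2) * (1 + y)"
    using False by (simp add: algebra_simps power2_eq_square)
  also have "\<dots> \<le> (1 - y + y\<^sup>2) * exp y"
    using assms by (intro mult_left_mono exp_ge_add_one_self) auto
  finally show ?thesis by (simp add: exp_minus field_simps)
qed

text \<open>The averaging property of conditional expectation, tested against bounded weights known
  to \<open>G\<close>. All conditional probabilities of the process enter the proof through it, so
  the argument runs on integrals instead of almost sure statements.\<close>

lemma (in prob_space) integral_mult_cond_pr:
  fixes h :: "'a \<Rightarrow> real"
  assumes "subalgebra M G" and h: "h \<in> borel_measurable G"
    and bound: "\<And>\<omega>. \<omega> \<in> space M \<Longrightarrow> \<bar>h \<omega>\<bar> \<le> B"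
    and P: "{\<omega> \<in> space M. P \<omega>} \<in> sets M"
  shows "integrable M (\<lambda>\<omega>. h \<omega> * cond_pr M G P \<omega>)"
    and "(\<integral>\<omega>. h \<omega> * cond_pr M G P \<omega> \<partial>M) = (\<integral>\<omega>. h \<omega> * of_bool (P \<omega>) \<partial>M)"
proof -
  interpret finite_measure_subalgebra M G
    using assms(1) by unfold_locales
  have hM: "h \<in> borel_measurable M"
    using measurable_from_subalg[OF assms(1) h] .
  have int: "integrable M (\<lambda>\<omega>. h \<omega> * indicat_real {\<omega> \<in> space M. P \<omega>} \<omega>)"
    using hM P bound by (intro integrable_const_bound[of _ "\<bar>B\<bar>"]) (auto simp: indicator_def intro!: AE_I2 order_trans[OF bound abs_ge_self])
  show "integrable M (\<lambda>\<omega>. h \<omega> * cond_pr M G P \<omega>)"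
    unfolding cond_pr_def using int h P by (intro real_cond_exp_intg) auto
  have "(\<integral>\<omega>. h \<omega> * cond_pr M G P \<omega> \<partial>M) = (\<integral>\<omega>. h \<omega> * indicat_real {\<omega> \<in> space M. P \<omega>} \<omega> \<partial>M)"
    unfolding cond_pr_def using int h P by (intro real_cond_exp_intg) auto
  also have "\<dots> = (\<integral>\<omega>. h \<omega> * of_bool (P \<omega>) \<partial>M)"
    by (intro Bochner_Integration.integral_cong) auto
  finally show "(\<integral>\<omega>. h \<omega> * cond_pr M G P \<omega> \<partial>M) = (\<integral>\<omega>. h \<omega> * of_bool (P \<omega>) \<partial>M)" .
qed

lemma space_reveal [simp]: "space (reveal G f) = space G"
  unfolding reveal_def by (intro space_measure_of) (use sets.space_closed in auto)

lemma sets_reveal: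
  "sets (reveal G f) = sigma_sets (space G) (sets G \<union> {f -` S \<inter> space G |S. True})"
  unfolding reveal_def using sets.space_closed by (intro sets_measure_of) auto

lemma subalgebra_reveal:
  assumes "subalgebra M G" and "\<And>S. f -` S \<inter> space G \<in> sets M"
  shows "subalgebra M (reveal G f)"
proof -
  have "sigma_sets (space M) (sets G \<union> {f -` S \<inter> space G |S. True}) \<subseteq> sets M"
    using assms by (intro sets.sigma_sets_subset) (auto simp: subalgebra_def)
  then show ?thesis
    using assms(1) by (simp add: subalgebra_def sets_reveal)
qed

lemma measurable_reveal:
  assumes "h \<in> measurable G N"
  shows "h \<in> measurable (reveal G f) N"
  using measurable_sets[OF assms] measurable_space[OF assms]
  by (auto simp: measurable_def sets_reveal)

lemma pred_reveal: "Measurable.pred (reveal G f) (\<lambda>\<omega>. P (f \<omega>))"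
proof -
  have "{\<omega> \<in> space G. P (f \<omega>)} = f -` {y. P y} \<inter> space G"
    by auto
  also have "\<dots> \<in> sets (reveal G f)"
    unfolding sets_reveal by blast
  finally show ?thesis
    by (simp add: Measurable.pred_def)
qed

lemma measurable_of_bool_real:
  "Measurable.pred N P \<Longrightarrow> (\<lambda>\<omega>. of_bool (P \<omega>) :: real) \<in> borel_measurable N"
  by measurable

section \<open>Arrivals, measurability and ranges\<close>

context sequential_selection_process
begin

abbreviation select :: "nat \<Rightarrow> 'e \<Rightarrow> 'w \<Rightarrow> real" where
  "select t e \<omega> \<equiv> of_bool (\<sigma> t \<omega> = e)"

text \<open>Indexed like \<open>p\<close>: it describes the start of step \<open>t\<close> and is
  known to \<open>F (t - 1)\<close>. Being real-valued, it can enter linear identities together with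
  \<open>p\<close>, \<open>X\<close> and \<Delta>.\<close>

definition unselected :: "nat \<Rightarrow> 'e \<Rightarrow> 'w \<Rightarrow> real" where
  "unselected t e \<omega> = of_bool (e \<notin> (\<lambda>s. \<sigma> s \<omega>) ` {1..<t})"

text \<open>Test functions that stand for conditioning on \<open>F (t - 1)\<close>. Nonnegativity
  preserves inequalities under the integral, boundedness gives integrability. The weight that
  matters in the end is the exponential of the potential before step \<open>t\<close>.\<close>

definition past_weight :: "nat \<Rightarrow> ('w \<Rightarrow> real) \<Rightarrow> bool" where
  "past_weight t h \<longleftrightarrow> h \<in> borel_measurable (F (t - 1)) \<and>
     (\<exists>B. \<forall>\<omega>\<in>space M. 0 \<le> h \<omega> \<and> h \<omega> \<le> B)"

lemma past_weight_nonneg: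
  "past_weight t h \<Longrightarrow> \<omega> \<in> space M \<Longrightarrow> 0 \<le> h \<omega>"
  by (auto simp: past_weight_def)

lemma past_weight_mult:
  assumes "past_weight t h" "past_weight t g"
  shows "past_weight t (\<lambda>\<omega>. h \<omega> * g \<omega>)"
proof -
  obtain B C where "\<forall>\<omega>\<in>space M. 0 \<le> h \<omega> \<and> h \<omega> \<le> B" "\<forall>\<omega>\<in>space M. 0 \<le> g \<omega> \<and> g \<omega> \<le> C"
    using assms by (auto simp: past_weight_def)
  then have "\<forall>\<omega>\<in>space M. 0 \<le> h \<omega> * g \<omega> \<and> h \<omega> * g \<omega> \<le> B * C"
    by (auto intro!: mult_mono intro: order_trans)
  then show ?thesis
    using assms by (auto simp: past_weight_def)
qed

lemma past_weight_integrable: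
  assumes h: "past_weight t h" and f: "f \<in> borel_measurable M"
    and bound: "\<And>\<omega>. \<omega> \<in> space M \<Longrightarrow> \<bar>f \<omega>\<bar> \<le> C"
  shows "integrable M (\<lambda>\<omega>. h \<omega> * f \<omega>)"
proof -
  obtain B where B: "\<forall>\<omega>\<in>space M. 0 \<le> h \<omega> \<and> h \<omega> \<le> B"
    using h by (auto simp: past_weight_def)
  have "h \<in> borel_measurable M"
    using h subalgebra_F[of "t - 1"] by (auto simp: past_weight_def intro: measurable_from_subalg)
  moreover have "\<bar>h \<omega> * f \<omega>\<bar> \<le> B * C" if "\<omega> \<in> space M" for \<omega>
    using B bound[OF that] that by (auto simp: abs_mult intro!: mult_mono intro: order_trans)
  ultimately show ?thesis
    using f by (intro integrable_const_bound[of _ "B * C"]) auto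
qed

lemma measurable_F_mono: "s \<le> t \<Longrightarrow> f \<in> measurable (F s) N \<Longrightarrow> f \<in> measurable (F t) N"
  using sets_F_mono[of s t] by (auto simp: measurable_def space_F)

lemma measurable_F_M: "f \<in> measurable (F t) N \<Longrightarrow> f \<in> measurable M N"
  using subalgebra_F by (rule measurable_from_subalg)

lemma pred_\<sigma>: "t \<in> {1..card U} \<Longrightarrow> Measurable.pred (F t) (\<lambda>\<omega>. \<sigma> t \<omega> = e)"
  using measurable_compose[OF adapted_\<sigma>, of t "\<lambda>y. y = e" "count_space UNIV"]
  by simp

lemma unselected_measurable:
  assumes "t \<le> card U + 1"
  shows "unselected t e \<in> borel_measurable (F (t - 1))"
proof -
  have "Measurable.pred (F (t - 1)) (\<lambda>\<omega>. \<forall>s\<in>{1..<t}. \<sigma> s \<omega> \<noteq> e)"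
  proof (intro pred_intros_finite pred_intros_logic)
    fix s assume "s \<in> {1..<t}"
    then show "Measurable.pred (F (t - 1)) (\<lambda>\<omega>. \<sigma> s \<omega> = e)"
      using assms by (intro measurable_F_mono[OF _ pred_\<sigma>[of s]]) auto
  qed simp
  then have "(\<lambda>\<omega>. of_bool (\<forall>s\<in>{1..<t}. \<sigma> s \<omega> \<noteq> e) :: real) \<in> borel_measurable (F (t - 1))"
    by (rule measurable_of_bool_real)
  also have "(\<lambda>\<omega>. of_bool (\<forall>s\<in>{1..<t}. \<sigma> s \<omega> \<noteq> e)) = unselected t e"
    by (auto simp: unselected_def fun_eq_iff)
  finally show ?thesis .
qed

lemma unselected_Suc:
  assumes "t \<in> {1..card U}" "\<omega> \<in> space M"
  shows "unselected (t + 1) e \<omega> = unselected t e \<omega> - select t e \<omega>"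
proof -
  have "{1..<t + 1} = insert t {1..<t}"
    using assms by auto
  then show ?thesis
    using \<sigma>_new[OF assms] by (auto simp: unselected_def)
qed

lemma select_le_unselected:
  "t \<in> {1..card U} \<Longrightarrow> \<omega> \<in> space M \<Longrightarrow> select t e \<omega> \<le> unselected t e \<omega>"
  using \<sigma>_new[of t \<omega>] by (auto simp: unselected_def)

lemma unselected_range: "0 \<le> unselected t e \<omega>" "unselected t e \<omega> \<le> 1"
  by (auto simp: unselected_def)

lemma past_weight_unselected: "t \<le> card U + 1 \<Longrightarrow> past_weight t (unselected t e)"
  unfolding past_weight_def using unselected_measurable unselected_range by blast

lemma sum_select:
  assumes "t \<in> {1..card U}" "\<omega> \<in> space M"
  shows "(\<Sum>e\<in>U. f e * select t e \<omega>) = f (\<sigma> t \<omega>)"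
proof -
  have "\<sigma> t \<omega> \<in> U"
    using \<sigma>_new[OF assms] by auto
  then show ?thesis
    by (subst sum.remove[OF finite_U, of "\<sigma> t \<omega>"]) (auto intro!: sum.neutral)
qed

lemma p_range:
  assumes "t \<in> {1..card U + 1}" "e \<in> U" "\<omega> \<in> space M"
  shows "0 \<le> p t e \<omega> \<and> p t e \<omega> \<le> x e"
  using assms(1)
\<comment> \<open>The induction starts at 1 because the process says nothing about
  \<open>p 0\<close>; the case \<open>ge\<close> is the side condition
  \<open>1 \<le> t\<close>.\<close>
proof (induction t rule: nat_induct_at_least[of 1, consumes 0, case_names ge base Suc])
  case ge
  then show ?case using assms(1) by simp
next
  case base
  then show ?case using p_init x_range assms by fastforce
next
  case (Suc t)
  then have "t \<in> {1..card U}" by auto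
  from \<Delta>_range[OF this assms(2,3)] \<Delta>_le_p[OF this assms(2,3)] p_step[OF this assms(2,3)] Suc
  show ?case by auto
qed

text \<open>Measurability is prescribed for \<open>\<Delta>\<close>; that of \<open>p\<close>
  follows along the recursion. The index \<open>t - 1\<close> expresses that \<open>p t\<close> is
  settled before step \<open>t\<close> begins.\<close>

lemma p_measurable:
  assumes "t \<in> {1..card U + 1}" "e \<in> U"
  shows "p t e \<in> borel_measurable (F (t - 1))"
  using assms(1)
proof (induction t rule: nat_induct_at_least[of 1, consumes 0, case_names ge base Suc])
  case ge
  then show ?case using assms(1) by simp
next
  case base
  have "p 1 e \<in> borel_measurable (F 0) \<longleftrightarrow> (\<lambda>_. x e) \<in> borel_measurable (F 0)"
    using p_init assms by (intro measurable_cong) (auto simp: space_F)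
  then show ?case by simp
next
  case (Suc t)
  then have t: "t \<in> {1..card U}" by auto
  have "p (t + 1) e \<in> borel_measurable (F t) \<longleftrightarrow>
      (\<lambda>\<omega>. p t e \<omega> - \<Delta> t e \<omega>) \<in> borel_measurable (F t)"
    using p_step[OF t assms(2)] by (intro measurable_cong) (auto simp: space_F)
  moreover have "p t e \<in> borel_measurable (F t)"
    using Suc by (intro measurable_F_mono[of "t - 1" t]) auto
  ultimately show ?case
    using adapted_\<Delta>[OF t assms(2)] by simp
qed

lemma past_weight_p: "t \<in> {1..card U + 1} \<Longrightarrow> e \<in> U \<Longrightarrow> past_weight t (p t e)"
  unfolding past_weight_def using p_measurable p_range by blast

text \<open>An entry changes only in the step in which its element arrives, so until then it keeps
  its initial value.\<close>

lemma X_bounds: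
  assumes "t \<le> card U" "e \<in> U" "\<omega> \<in> space M"
  shows "X t e \<omega> \<in> {0, 1}" and "e \<notin> (\<lambda>s. \<sigma> s \<omega>) ` {1..t} \<Longrightarrow> X t e \<omega> = 0"
proof -
  have "X t e \<omega> \<in> {0, 1} \<and> (e \<notin> (\<lambda>s. \<sigma> s \<omega>) ` {1..t} \<longrightarrow> X t e \<omega> = 0)"
    using assms(1)
  proof (induction t)
    case 0
    then show ?case using X_init assms by simp
  next
    case (Suc t)
    then have t: "Suc t \<in> {1..card U}" by auto
    show ?case
    proof (cases "e = \<sigma> (Suc t) \<omega>")
      case True
      then show ?thesis using X_range[OF t assms(3)] by auto
    next
      case False
      then show ?thesis using X_other[OF t assms(2,3) False] Suc
        by (auto simp: image_iff le_Suc_eq)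
    qed
  qed
  then show "X t e \<omega> \<in> {0, 1}" "e \<notin> (\<lambda>s. \<sigma> s \<omega>) ` {1..t} \<Longrightarrow> X t e \<omega> = 0"
    by auto
qed

text \<open>Replaces the case distinction of the process by a linear identity: an element arriving
  now has not arrived before, so its entry was still 0.\<close>

lemma X_step:
  assumes "t \<in> {1..card U}" "e \<in> U" "\<omega> \<in> space M"
  shows "X t e \<omega> = X (t - 1) e \<omega> + select t e \<omega> * X t e \<omega>"
proof (cases "e = \<sigma> t \<omega>")
  case True
  have "{1..t - 1} = {1..<t}"
    using assms by auto
  then have "X (t - 1) e \<omega> = 0"
    using \<sigma>_new[OF assms(1,3)] True assms by (intro X_bounds) auto
  then show ?thesis using True by simp
next
  case False
  then show ?thesis using X_other[OF assms] by auto
qed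

text \<open>Justifies stopping the analysis early: what is collected up to an intermediate time is
  never lost.\<close>

lemma X_mono:
  assumes "s \<le> t" "t \<le> card U" "e \<in> U" "\<omega> \<in> space M"
  shows "X s e \<omega> \<le> X t e \<omega>"
  using assms(1,2)
proof (induction t rule: dec_induct)
  case (step t)
  then have "X t e \<omega> \<le> X (Suc t) e \<omega>"
    using X_step[of "Suc t" e \<omega>] X_bounds(1)[of "Suc t" e \<omega>] X_bounds(1)[of t e \<omega>] assms by auto
  then show ?case using step by auto
qed simp

lemma X_measurable:
  assumes "t \<le> card U" "e \<in> U"
  shows "X t e \<in> borel_measurable (F t)"
proof (cases "t = 0")
  case True
  have "X 0 e \<in> borel_measurable (F 0) \<longleftrightarrow> (\<lambda>_. 0 :: real) \<in> borel_measurable (F 0)"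
    using X_init assms by (intro measurable_cong) (auto simp: space_F)
  then show ?thesis using True by simp
next
  case False
  then show ?thesis using adapted_X assms by auto
qed

section \<open>Conditional means within one step, in integrated form\<close>

lemma integral_select:
  assumes t: "t \<in> {1..card U}" and e: "e \<in> U" and h: "past_weight t h"
  shows "(\<integral>\<omega>. h \<omega> * select t e \<omega> \<partial>M) =
    (\<integral>\<omega>. h \<omega> * unselected t e \<omega> \<partial>M) / (real (card U) - real t + 1)"
proof -
  \<comment> \<open>The factor \<open>unselected t e\<close> belongs to the weight because
    \<sigma>_uniform speaks only of elements that have not arrived; for the others both sides of the
    claim vanish.\<close>
  let ?m = "real (card U) - real t + 1" and ?g = "\<lambda>\<omega>. h \<omega> * unselected t e \<omega>"
  have g: "past_weight t ?g"
    using t h by (intro past_weight_mult past_weight_unselected) auto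
  then obtain B where B: "\<And>\<omega>. \<omega> \<in> space M \<Longrightarrow> \<bar>?g \<omega>\<bar> \<le> B"
    by (fastforce simp: past_weight_def)
  have P: "{\<omega> \<in> space M. \<sigma> t \<omega> = e} \<in> sets M"
    using measurable_F_M[OF pred_\<sigma>[OF t, of e]] by (simp add: Measurable.pred_def)
  have gF: "?g \<in> borel_measurable (F (t - 1))"
    using g by (simp add: past_weight_def)
  note cp = integral_mult_cond_pr[OF subalgebra_F gF B P]
  have "(\<integral>\<omega>. h \<omega> * select t e \<omega> \<partial>M) = (\<integral>\<omega>. ?g \<omega> * select t e \<omega> \<partial>M)"
    using select_le_unselected[OF t, of _ e]
    by (intro Bochner_Integration.integral_cong) (auto simp: unselected_def split: if_splits)
  also have "\<dots> = (\<integral>\<omega>. ?g \<omega> * cond_pr M (F (t - 1)) (\<lambda>\<omega>'. \<sigma> t \<omega>' = e) \<omega> \<partial>M)"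
    using cp by simp
  also have "\<dots> = (\<integral>\<omega>. ?g \<omega> / ?m \<partial>M)"
  proof (rule integral_cong_AE)
    show "(\<lambda>\<omega>. ?g \<omega> * cond_pr M (F (t - 1)) (\<lambda>\<omega>'. \<sigma> t \<omega>' = e) \<omega>) \<in> borel_measurable M"
      using cp(1) by simp
    show "(\<lambda>\<omega>. ?g \<omega> / ?m) \<in> borel_measurable M"
      using measurable_F_M[OF gF] by simp
    show "AE \<omega> in M. ?g \<omega> * cond_pr M (F (t - 1)) (\<lambda>\<omega>'. \<sigma> t \<omega>' = e) \<omega> = ?g \<omega> / ?m"
      using \<sigma>_uniform[OF t e] by (auto simp: unselected_def elim!: eventually_mono)
  qed
  finally show ?thesis by simp
qed

lemma subalgebra_reveal_\<sigma>:
  assumes t: "t \<in> {1..card U}"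
  shows "subalgebra M (reveal (F (t - 1)) (\<sigma> t))"
proof (rule subalgebra_reveal[OF subalgebra_F])
  fix S
  \<comment> \<open>Measurability of \<open>\<sigma> t\<close> is available only into
    \<open>count_space U\<close>, so an arbitrary \<open>S\<close> is first cut down to
    \<open>U\<close>.\<close>
  have "\<sigma> t -` S \<inter> space (F (t - 1)) = \<sigma> t -` (S \<inter> U) \<inter> space M"
    using \<sigma>_new[OF t] by (auto simp: space_F)
  then show "\<sigma> t -` S \<inter> space (F (t - 1)) \<in> sets M"
    using measurable_sets[OF measurable_F_M[OF adapted_\<sigma>[OF t]], of "S \<inter> U"] by simp
qed

text \<open>A preimage under the pair splits according to the membership bit into two pieces, each
  an event about \<open>\<sigma> t\<close> intersected with one about membership.\<close>

lemma subalgebra_reveal_\<sigma>_R: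
  assumes t: "t \<in> {1..card U}"
  shows "subalgebra M (reveal (F (t - 1)) (\<lambda>\<omega>. (\<sigma> t \<omega>, \<sigma> t \<omega> \<in> R \<omega>)))"
proof (rule subalgebra_reveal[OF subalgebra_F])
  fix S
  have R: "Measurable.pred M (\<lambda>\<omega>. \<sigma> t \<omega> \<in> R \<omega>)"
    using measurable_F_M[OF adapted_R[OF t]] .
  have \<sigma>: "\<sigma> t -` V \<inter> space M \<in> sets M" if "V \<subseteq> U" for V
    using measurable_sets[OF measurable_F_M[OF adapted_\<sigma>[OF t]], of V] that by simp
  have "(\<lambda>\<omega>. (\<sigma> t \<omega>, \<sigma> t \<omega> \<in> R \<omega>)) -` S \<inter> space (F (t - 1)) =
      (\<sigma> t -` {e \<in> U. (e, True) \<in> S} \<inter> space M) \<inter> {\<omega> \<in> space M. \<sigma> t \<omega> \<in> R \<omega>} \<union>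
      (\<sigma> t -` {e \<in> U. (e, False) \<in> S} \<inter> space M) \<inter> {\<omega> \<in> space M. \<not> \<sigma> t \<omega> \<in> R \<omega>}"
  proof (intro set_eqI)
    fix \<omega>
    show "\<omega> \<in> (\<lambda>\<omega>. (\<sigma> t \<omega>, \<sigma> t \<omega> \<in> R \<omega>)) -` S \<inter> space (F (t - 1)) \<longleftrightarrow> \<omega> \<in>
      (\<sigma> t -` {e \<in> U. (e, True) \<in> S} \<inter> space M) \<inter> {\<omega> \<in> space M. \<sigma> t \<omega> \<in> R \<omega>} \<union>
      (\<sigma> t -` {e \<in> U. (e, False) \<in> S} \<inter> space M) \<inter> {\<omega> \<in> space M. \<not> \<sigma> t \<omega> \<in> R \<omega>}"
      using \<sigma>_new[OF t, of \<omega>] by (cases "\<sigma> t \<omega> \<in> R \<omega>") (auto simp: space_F)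
  qed
  also have "\<dots> \<in> sets M"
    using R by (intro sets.Un sets.Int \<sigma>) auto
  finally show "(\<lambda>\<omega>. (\<sigma> t \<omega>, \<sigma> t \<omega> \<in> R \<omega>)) -` S \<inter> space (F (t - 1)) \<in> sets M" .
qed

text \<open>Once \<open>\<sigma> t\<close> is revealed, \<open>select t e\<close> is part of the
  weight, and where it is nonzero the membership probability \<open>x (\<sigma> t \<omega>)\<close>
  is the constant \<open>x e\<close>.\<close>

lemma integral_select_R:
  assumes t: "t \<in> {1..card U}" and h: "past_weight t h"
  shows "(\<integral>\<omega>. h \<omega> * select t e \<omega> * of_bool (\<sigma> t \<omega> \<in> R \<omega>) \<partial>M) =
    x e * (\<integral>\<omega>. h \<omega> * select t e \<omega> \<partial>M)"
proof -
  let ?g = "\<lambda>\<omega>. h \<omega> * select t e \<omega>" and ?G = "reveal (F (t - 1)) (\<sigma> t)"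
  obtain B where B: "\<And>\<omega>. \<omega> \<in> space M \<Longrightarrow> 0 \<le> h \<omega> \<and> h \<omega> \<le> B"
    using h by (auto simp: past_weight_def)
  have bound: "\<bar>?g \<omega>\<bar> \<le> B" if "\<omega> \<in> space M" for \<omega>
    using B[OF that] by auto
  have g: "?g \<in> borel_measurable ?G"
    using h by (intro borel_measurable_times measurable_reveal measurable_of_bool_real pred_reveal)
      (auto simp: past_weight_def)
  have P: "{\<omega> \<in> space M. \<sigma> t \<omega> \<in> R \<omega>} \<in> sets M"
    using measurable_F_M[OF adapted_R[OF t]] by (simp add: Measurable.pred_def)
  note cp = integral_mult_cond_pr[OF subalgebra_reveal_\<sigma>[OF t] g bound P]
  have "(\<integral>\<omega>. ?g \<omega> * of_bool (\<sigma> t \<omega> \<in> R \<omega>) \<partial>M) =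
      (\<integral>\<omega>. ?g \<omega> * cond_pr M ?G (\<lambda>\<omega>. \<sigma> t \<omega> \<in> R \<omega>) \<omega> \<partial>M)"
    using cp by simp
  also have "\<dots> = (\<integral>\<omega>. x e * ?g \<omega> \<partial>M)"
    using R_prob[OF t] cp(1) measurable_from_subalg[OF subalgebra_reveal_\<sigma>[OF t] g]
    by (intro integral_cong_AE) (auto elim!: eventually_mono)
  finally show ?thesis by simp
qed

text \<open>Only members of \<open>R\<close> can be accepted. This upper estimate later controls the
  mean size of an increment.\<close>

lemma integral_select_X_le:
  assumes t: "t \<in> {1..card U}" and e: "e \<in> U" and h: "past_weight t h"
  shows "(\<integral>\<omega>. h \<omega> * (select t e \<omega> * X t e \<omega>) \<partial>M) \<le> x e * (\<integral>\<omega>. h \<omega> * select t e \<omega> \<partial>M)"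
proof -
  note pos = past_weight_nonneg[OF h]
  have meas: "X t e \<in> borel_measurable M" "Measurable.pred M (\<lambda>\<omega>. \<sigma> t \<omega> \<in> R \<omega>)"
    "Measurable.pred M (\<lambda>\<omega>. \<sigma> t \<omega> = e)"
    using measurable_F_M[OF adapted_X[OF t e]] measurable_F_M[OF adapted_R[OF t]]
      measurable_F_M[OF pred_\<sigma>[OF t]] by auto
  have "(\<integral>\<omega>. h \<omega> * (select t e \<omega> * X t e \<omega>) \<partial>M) \<le>
      (\<integral>\<omega>. h \<omega> * (select t e \<omega> * of_bool (\<sigma> t \<omega> \<in> R \<omega>)) \<partial>M)"
  proof (rule integral_mono)
    show "integrable M (\<lambda>\<omega>. h \<omega> * (select t e \<omega> * X t e \<omega>))"
      using meas X_bounds(1)[OF _ e] t by (intro past_weight_integrable[OF h, of _ 1]) fastforce+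
    show "integrable M (\<lambda>\<omega>. h \<omega> * (select t e \<omega> * of_bool (\<sigma> t \<omega> \<in> R \<omega>)))"
      using meas by (intro past_weight_integrable[OF h, of _ 1]) auto
    show "h \<omega> * (select t e \<omega> * X t e \<omega>) \<le> h \<omega> * (select t e \<omega> * of_bool (\<sigma> t \<omega> \<in> R \<omega>))"
      if "\<omega> \<in> space M" for \<omega>
      using pos[OF that] X_outside_R[OF t that] X_range[OF t that]
      by (cases "\<sigma> t \<omega> = e"; cases "\<sigma> t \<omega> \<in> R \<omega>") auto
  qed
  then show ?thesis using integral_select_R[OF t h, of e] by (simp add: mult.assoc)
qed

text \<open>An arriving element is in \<open>R\<close> with probability \<open>x e\<close> and is
  then accepted with probability at least \<open>p t e / x e\<close>; the factors \<open>x e\<close>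
  cancel.\<close>

lemma integral_select_X_ge:
  assumes t: "t \<in> {1..card U}" and e: "e \<in> U" and h: "past_weight t h"
  shows "(\<integral>\<omega>. h \<omega> * (select t e \<omega> * p t e \<omega>) \<partial>M) \<le> (\<integral>\<omega>. h \<omega> * (select t e \<omega> * X t e \<omega>) \<partial>M)"
proof (cases "x e = 0")
  \<comment> \<open>Here \<open>p_range\<close> forces \<open>p t e\<close> to vanish, so the
    quotient by \<open>x e\<close> is avoided.\<close>
  case True
  note pos = past_weight_nonneg[OF h]
  have "(\<integral>\<omega>. h \<omega> * (select t e \<omega> * p t e \<omega>) \<partial>M) = (\<integral>\<omega>. 0 \<partial>M)"
    using p_range[of t e] t e True by (intro Bochner_Integration.integral_cong) (auto, force)
  also have "\<dots> \<le> (\<integral>\<omega>. h \<omega> * (select t e \<omega> * X t e \<omega>) \<partial>M)"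
    using pos X_bounds(1)[OF _ e, of t] t
    by (simp, intro Bochner_Integration.integral_nonneg_AE AE_I2) fastforce
  finally show ?thesis .
next
  case False
  let ?G = "reveal (F (t - 1)) (\<lambda>\<omega>. (\<sigma> t \<omega>, \<sigma> t \<omega> \<in> R \<omega>))"
  let ?g = "\<lambda>\<omega>. h \<omega> * of_bool (\<sigma> t \<omega> = e \<and> \<sigma> t \<omega> \<in> R \<omega>)"
  let ?C = "cond_pr M ?G (\<lambda>\<omega>. X t (\<sigma> t \<omega>) \<omega> = 1)"
  have xe: "x e > 0" using False x_range[OF e] by auto
  obtain B where B: "\<And>\<omega>. \<omega> \<in> space M \<Longrightarrow> 0 \<le> h \<omega> \<and> h \<omega> \<le> B"
    using h by (auto simp: past_weight_def)
  have bound: "\<bar>?g \<omega>\<bar> \<le> B" if "\<omega> \<in> space M" for \<omega>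
    using B[OF that] by auto
  have pred: "Measurable.pred ?G (\<lambda>\<omega>. \<sigma> t \<omega> = e \<and> \<sigma> t \<omega> \<in> R \<omega>)"
    using pred_reveal[where P = "\<lambda>(y, b). y = e \<and> b" and f = "\<lambda>\<omega>. (\<sigma> t \<omega>, \<sigma> t \<omega> \<in> R \<omega>)"]
    by simp
  have g: "?g \<in> borel_measurable ?G"
    using h by (intro borel_measurable_times measurable_of_bool_real[OF pred] measurable_reveal)
      (auto simp: past_weight_def)
  have meas: "X t e' \<in> borel_measurable M" "Measurable.pred M (\<lambda>\<omega>. \<sigma> t \<omega> \<in> R \<omega>)"
    "Measurable.pred M (\<lambda>\<omega>. \<sigma> t \<omega> = e')" if "e' \<in> U" for e'
    using measurable_F_M[OF adapted_X[OF t that]] measurable_F_M[OF adapted_R[OF t]]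
      measurable_F_M[OF pred_\<sigma>[OF t]] by auto
  \<comment> \<open>Measurability of \<open>X\<close> is known for a fixed element only, so the
    event is split over the finitely many values of \<open>\<sigma> t\<close>.\<close>
  have "{\<omega> \<in> space M. X t (\<sigma> t \<omega>) \<omega> = 1} = (\<Union>e'\<in>U. {\<omega> \<in> space M. \<sigma> t \<omega> = e' \<and> X t e' \<omega> = 1})"
    using \<sigma>_new[OF t] by auto
  also have "\<dots> \<in> sets M"
    using meas finite_U by (intro sets.finite_UN) auto
  finally have P: "{\<omega> \<in> space M. X t (\<sigma> t \<omega>) \<omega> = 1} \<in> sets M" .
  note cp = integral_mult_cond_pr[OF subalgebra_reveal_\<sigma>_R[OF t] g bound P]
  \<comment> \<open>Since \<open>p t e\<close> is known before step \<open>t\<close>, it can be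
    absorbed into the weight; \<open>integral_select_R\<close> for this weight then supplies the
    factor \<open>x e\<close> to be cancelled.\<close>
  have hp: "past_weight t (\<lambda>\<omega>. h \<omega> * p t e \<omega>)"
    using h e t by (intro past_weight_mult past_weight_p) auto
  have "(\<integral>\<omega>. h \<omega> * (select t e \<omega> * p t e \<omega>) \<partial>M) =
      (\<integral>\<omega>. (h \<omega> * p t e \<omega>) * select t e \<omega> * of_bool (\<sigma> t \<omega> \<in> R \<omega>) \<partial>M) / x e"
    using integral_select_R[OF t hp, of e] xe by (simp add: ac_simps)
  also have "\<dots> = (\<integral>\<omega>. ?g \<omega> * (p t e \<omega> / x e) \<partial>M)"
    by (subst integral_divide_zero[symmetric]) (intro Bochner_Integration.integral_cong, auto)
  also have "\<dots> \<le> (\<integral>\<omega>. ?g \<omega> * ?C \<omega> \<partial>M)"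
  proof (rule integral_mono_AE)
    have "integrable M (\<lambda>\<omega>. h \<omega> * p t e \<omega> * (of_bool (\<sigma> t \<omega> = e \<and> \<sigma> t \<omega> \<in> R \<omega>) / x e))"
      using meas[OF e] xe by (intro past_weight_integrable[OF hp, of _ "1 / x e"]) auto
    then show "integrable M (\<lambda>\<omega>. ?g \<omega> * (p t e \<omega> / x e))"
      by (simp add: ac_simps)
    show "integrable M (\<lambda>\<omega>. ?g \<omega> * ?C \<omega>)"
      by (rule cp(1))
    show "AE \<omega> in M. ?g \<omega> * (p t e \<omega> / x e) \<le> ?g \<omega> * ?C \<omega>"
      using X_prob[OF t] AE_space
    proof eventually_elim
      case (elim \<omega>)
      then show ?case
        using B[of \<omega>] by (cases "\<sigma> t \<omega> = e \<and> \<sigma> t \<omega> \<in> R \<omega>") (auto simp del: times_divide_eq_right intro!: mult_left_mono)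
    qed
  qed
  also have "\<dots> = (\<integral>\<omega>. ?g \<omega> * of_bool (X t (\<sigma> t \<omega>) \<omega> = 1) \<partial>M)"
    by (rule cp(2))
  also have "\<dots> = (\<integral>\<omega>. h \<omega> * (select t e \<omega> * X t e \<omega>) \<partial>M)"
    using X_outside_R[OF t] X_range[OF t]
    by (intro Bochner_Integration.integral_cong) fastforce+
  finally show ?thesis .
qed

end

text \<open>The bound on the conditional mean, brought into the same integrated form as the facts on
  selection.\<close>

lemma (in bounded_sequential_selection_process) integral_\<Delta>_le:
  assumes t: "t \<in> {1..card U}" and e: "e \<in> U" and h: "past_weight t h"
  shows "(\<integral>\<omega>. h \<omega> * \<Delta> t e \<omega> \<partial>M) \<le> lam * x e / (real (card U) - real t + 1) * (\<integral>\<omega>. h \<omega> \<partial>M)"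
proof -
  interpret finite_measure_subalgebra M "F (t - 1)"
    using subalgebra_F by unfold_locales
  let ?C = "real_cond_exp M (F (t - 1)) (\<Delta> t e)" and ?b = "lam * x e / (real (card U) - real t + 1)"
  note pos = past_weight_nonneg[OF h]
  have hF: "h \<in> borel_measurable (F (t - 1))"
    using h by (simp add: past_weight_def)
  have \<Delta>M: "\<Delta> t e \<in> borel_measurable M"
    using measurable_F_M[OF adapted_\<Delta>[OF t e]] .
  have int: "integrable M (\<lambda>\<omega>. h \<omega> * \<Delta> t e \<omega>)"
    using \<Delta>M \<Delta>_range[OF t e] by (intro past_weight_integrable[OF h, of _ 1]) auto
  have "(\<integral>\<omega>. h \<omega> * \<Delta> t e \<omega> \<partial>M) = (\<integral>\<omega>. h \<omega> * ?C \<omega> \<partial>M)"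
    using real_cond_exp_intg(2)[OF int hF \<Delta>M] by simp
  also have "\<dots> \<le> (\<integral>\<omega>. h \<omega> * ?b \<partial>M)"
  proof (rule integral_mono_AE)
    show "integrable M (\<lambda>\<omega>. h \<omega> * ?C \<omega>)"
      using real_cond_exp_intg(1)[OF int hF \<Delta>M] .
    show "integrable M (\<lambda>\<omega>. h \<omega> * ?b)"
      by (intro past_weight_integrable[OF h, of _ "\<bar>?b\<bar>"]) auto
    show "AE \<omega> in M. h \<omega> * ?C \<omega> \<le> h \<omega> * ?b"
      using bounded[OF t e] AE_space
      by eventually_elim (intro mult_left_mono pos)
  qed
  finally show ?thesis by (simp add: mult.commute)
qed

section \<open>One-step increments: drift, mean size and pointwise bound\<close>

context strongly_bounded_sequential_selection_process
begin

text \<open>The coefficients are kept free so that one computation serves both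
  \<open>increment\<close> and \<open>abs_increment\<close>. The two middle terms are evaluated by
  uniformity of the arrival; those with \<open>X\<close> and \<open>\<Delta>\<close> remain, as only
  inequalities are available for them.\<close>

lemma integral_contribution:
  assumes t: "t \<in> {1..card U}" and e: "e \<in> U" and h: "past_weight t h"
  defines "m \<equiv> real (card U) - real t + 1"
  shows "integrable M (\<lambda>\<omega>. h \<omega> * (select t e \<omega> * X t e \<omega> + \<alpha> * (p t e \<omega> * select t e \<omega>) +
      \<beta> * select t e \<omega> + \<gamma> * (unselected t e \<omega> * \<Delta> t e \<omega>)))" (is ?int)
    and "(\<integral>\<omega>. h \<omega> * (select t e \<omega> * X t e \<omega> + \<alpha> * (p t e \<omega> * select t e \<omega>) +
      \<beta> * select t e \<omega> + \<gamma> * (unselected t e \<omega> * \<Delta> t e \<omega>)) \<partial>M) =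
      (\<integral>\<omega>. h \<omega> * (select t e \<omega> * X t e \<omega>) \<partial>M) + \<alpha> / m * (\<integral>\<omega>. h \<omega> * (p t e \<omega> * unselected t e \<omega>) \<partial>M) +
      \<beta> / m * (\<integral>\<omega>. h \<omega> * unselected t e \<omega> \<partial>M) + \<gamma> * (\<integral>\<omega>. h \<omega> * (unselected t e \<omega> * \<Delta> t e \<omega>) \<partial>M)" (is ?eq)
proof -
  have meas: "X t e \<in> borel_measurable M" "Measurable.pred M (\<lambda>\<omega>. \<sigma> t \<omega> = e)"
    "p t e \<in> borel_measurable M" "unselected t e \<in> borel_measurable M" "\<Delta> t e \<in> borel_measurable M"
    using measurable_F_M[OF adapted_X[OF t e]] measurable_F_M[OF pred_\<sigma>[OF t]]
      measurable_F_M[OF p_measurable[of t e]] measurable_F_M[OF unselected_measurable[of t e]]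
      measurable_F_M[OF adapted_\<Delta>[OF t e]] t e by auto
  note integrable = past_weight_integrable[OF h, of _ 1]
  have p: "\<bar>p t e \<omega>\<bar> \<le> 1" if "\<omega> \<in> space M" for \<omega>
    using p_range[of t e \<omega>] x_range[OF e] t e that by auto
  have u: "\<bar>unselected t e \<omega>\<bar> \<le> 1" for \<omega>
    using unselected_range[of t e \<omega>] by auto
  have i1: "integrable M (\<lambda>\<omega>. h \<omega> * (select t e \<omega> * X t e \<omega>))"
    using meas X_bounds(1)[OF _ e, of t] t by (intro integrable) fastforce+
  have i2: "integrable M (\<lambda>\<omega>. h \<omega> * (p t e \<omega> * select t e \<omega>))"
    using meas p by (intro integrable) auto
  have i3: "integrable M (\<lambda>\<omega>. h \<omega> * select t e \<omega>)"
    using meas by (intro integrable) auto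
  have i4: "integrable M (\<lambda>\<omega>. h \<omega> * (unselected t e \<omega> * \<Delta> t e \<omega>))"
    using meas u \<Delta>_range[OF t e] by (intro integrable) (auto simp: abs_mult intro!: mult_le_one)
  have expand: "h \<omega> * (select t e \<omega> * X t e \<omega> + \<alpha> * (p t e \<omega> * select t e \<omega>) +
      \<beta> * select t e \<omega> + \<gamma> * (unselected t e \<omega> * \<Delta> t e \<omega>)) =
    h \<omega> * (select t e \<omega> * X t e \<omega>) + \<alpha> * (h \<omega> * (p t e \<omega> * select t e \<omega>)) +
      \<beta> * (h \<omega> * select t e \<omega>) + \<gamma> * (h \<omega> * (unselected t e \<omega> * \<Delta> t e \<omega>))" for \<omega>
    by (simp add: algebra_simps)
  show ?int
    unfolding expand by (intro Bochner_Integration.integrable_add integrable_mult_right i1 i2 i3 i4)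
  have hp: "past_weight t (\<lambda>\<omega>. h \<omega> * p t e \<omega>)"
    using h e t by (intro past_weight_mult past_weight_p) auto
  have s2: "(\<integral>\<omega>. h \<omega> * (p t e \<omega> * select t e \<omega>) \<partial>M) = (\<integral>\<omega>. h \<omega> * (p t e \<omega> * unselected t e \<omega>) \<partial>M) / m"
    using integral_select[OF t e hp] by (simp add: m_def mult.assoc)
  show ?eq
    unfolding expand using i1 i2 i3 i4 s2 integral_select[OF t e h] by (simp add: m_def)
qed

context
  fixes a :: "'e \<Rightarrow> real"
  assumes a: "\<And>e. e \<in> U \<Longrightarrow> a e \<in> {0..1}"
begin

text \<open>\<open>gain\<close>, \<open>rest_p\<close> and \<open>rest_x\<close> are
  \<open>A\<close>, \<open>Y\<close> and \<open>Z\<close> of the overview. \<open>gain t\<close>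
  refers to the end of step \<open>t\<close>, the other two to its start, so they are paired with
  index \<open>t + 1\<close> after step \<open>t\<close>.\<close>

definition gain :: "nat \<Rightarrow> 'w \<Rightarrow> real" where
  "gain t \<omega> = (\<Sum>e\<in>U. a e * X t e \<omega>)"

definition rest_p :: "nat \<Rightarrow> 'w \<Rightarrow> real" where
  "rest_p t \<omega> = (\<Sum>e\<in>U. a e * (p t e \<omega> * unselected t e \<omega>))"

definition rest_x :: "nat \<Rightarrow> 'w \<Rightarrow> real" where
  "rest_x t \<omega> = (\<Sum>e\<in>U. a e * (x e * unselected t e \<omega>))"

text \<open>Almost the change of \<open>A + c * (Y - \<kappa> * Z)\<close> in step \<open>t\<close>
  for fixed \<open>c\<close>. The exact change would charge \<open>\<Delta> t\<close> only to
  elements that remain after the step; charging it also to the arriving one makes its coefficient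
  known in advance, at the price of a lower bound.\<close>

definition increment :: "nat \<Rightarrow> real \<Rightarrow> real \<Rightarrow> 'w \<Rightarrow> real" where
  "increment t c \<kappa> \<omega> = (\<Sum>e\<in>U. a e * (select t e \<omega> * X t e \<omega> + (- c) * (p t e \<omega> * select t e \<omega>) +
      c * \<kappa> * x e * select t e \<omega> + (- c) * (unselected t e \<omega> * \<Delta> t e \<omega>)))"

text \<open>The same sum with all signs positive. It dominates the absolute value of
  \<open>increment\<close> yet stays linear, so its mean can be computed in the same way.\<close>

definition abs_increment :: "nat \<Rightarrow> real \<Rightarrow> real \<Rightarrow> 'w \<Rightarrow> real" where
  "abs_increment t c \<kappa> \<omega> = (\<Sum>e\<in>U. a e * (select t e \<omega> * X t e \<omega> + c * (p t e \<omega> * select t e \<omega>) +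
      c * \<kappa> * x e * select t e \<omega> + c * (unselected t e \<omega> * \<Delta> t e \<omega>)))"

lemma gain_measurable: "t \<le> card U \<Longrightarrow> gain t \<in> borel_measurable (F t)"
  unfolding gain_def using X_measurable by (intro borel_measurable_sum borel_measurable_times) auto

lemma rest_p_measurable: "t \<in> {1..card U + 1} \<Longrightarrow> rest_p t \<in> borel_measurable (F (t - 1))"
  unfolding rest_p_def using p_measurable unselected_measurable
  by (intro borel_measurable_sum borel_measurable_times) auto

lemma rest_x_measurable: "t \<in> {1..card U + 1} \<Longrightarrow> rest_x t \<in> borel_measurable (F (t - 1))"
  unfolding rest_x_def using unselected_measurable
  by (intro borel_measurable_sum borel_measurable_times) auto

lemma gain_nonneg: "t \<le> card U \<Longrightarrow> \<omega> \<in> space M \<Longrightarrow> 0 \<le> gain t \<omega>"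
  unfolding gain_def using X_bounds(1)[of t] a by (intro sum_nonneg mult_nonneg_nonneg) fastforce+

lemma gain_mono:
  "s \<le> t \<Longrightarrow> t \<le> card U \<Longrightarrow> \<omega> \<in> space M \<Longrightarrow> gain s \<omega> \<le> gain t \<omega>"
  unfolding gain_def using X_mono a by (intro sum_mono mult_left_mono) auto

lemma rest_p_nonneg: "t \<in> {1..card U + 1} \<Longrightarrow> \<omega> \<in> space M \<Longrightarrow> 0 \<le> rest_p t \<omega>"
  unfolding rest_p_def using p_range a unselected_range
  by (intro sum_nonneg mult_nonneg_nonneg) auto

lemma rest_x_nonneg: "0 \<le> rest_x t \<omega>"
  unfolding rest_x_def using x_range a unselected_range
  by (intro sum_nonneg mult_nonneg_nonneg) auto

lemma rest_x_le: "rest_x t \<omega> \<le> (\<Sum>e\<in>U. a e * x e)"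
  unfolding rest_x_def using x_range a by (intro sum_mono mult_left_mono) (auto simp: unselected_def)

lemma integral_weighted_sum:
  assumes "\<And>e. e \<in> U \<Longrightarrow> integrable M (\<lambda>\<omega>. h \<omega> * f e \<omega>)"
  shows "integrable M (\<lambda>\<omega>. h \<omega> * (\<Sum>e\<in>U. a e * f e \<omega>))"
    and "(\<integral>\<omega>. h \<omega> * (\<Sum>e\<in>U. a e * f e \<omega>) \<partial>M) = (\<Sum>e\<in>U. a e * (\<integral>\<omega>. h \<omega> * f e \<omega> \<partial>M))"
proof -
  have eq: "h \<omega> * (\<Sum>e\<in>U. a e * f e \<omega>) = (\<Sum>e\<in>U. a e * (h \<omega> * f e \<omega>))" for \<omega>
    by (simp add: sum_distrib_left mult.left_commute)
  show "integrable M (\<lambda>\<omega>. h \<omega> * (\<Sum>e\<in>U. a e * f e \<omega>))"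
    unfolding eq by (intro Bochner_Integration.integrable_sum integrable_mult_right assms)
  show "(\<integral>\<omega>. h \<omega> * (\<Sum>e\<in>U. a e * f e \<omega>) \<partial>M) = (\<Sum>e\<in>U. a e * (\<integral>\<omega>. h \<omega> * f e \<omega> \<partial>M))"
    unfolding eq using assms by (simp add: Bochner_Integration.integral_sum)
qed

lemma integral_rest:
  assumes t: "t \<in> {1..card U}" and h: "past_weight t h"
  shows "integrable M (\<lambda>\<omega>. h \<omega> * rest_p t \<omega>)" "integrable M (\<lambda>\<omega>. h \<omega> * rest_x t \<omega>)"
    "(\<integral>\<omega>. h \<omega> * rest_p t \<omega> \<partial>M) = (\<Sum>e\<in>U. a e * (\<integral>\<omega>. h \<omega> * (p t e \<omega> * unselected t e \<omega>) \<partial>M))"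
    "(\<integral>\<omega>. h \<omega> * rest_x t \<omega> \<partial>M) = (\<Sum>e\<in>U. a e * (x e * (\<integral>\<omega>. h \<omega> * unselected t e \<omega> \<partial>M)))"
proof -
  have u: "\<bar>unselected t e \<omega>\<bar> \<le> 1" for e \<omega>
    using unselected_range[of t e \<omega>] by auto
  have uM: "unselected t e \<in> borel_measurable M" for e
    using measurable_F_M[OF unselected_measurable[of t e]] t by auto
  have p: "\<bar>p t e \<omega>\<bar> \<le> 1" if "e \<in> U" "\<omega> \<in> space M" for e \<omega>
    using p_range[of t e \<omega>] x_range[of e] t that by auto
  have pM: "p t e \<in> borel_measurable M" if "e \<in> U" for e
    using measurable_F_M[OF p_measurable[of t e]] t that by auto
  have ip: "integrable M (\<lambda>\<omega>. h \<omega> * (p t e \<omega> * unselected t e \<omega>))" if "e \<in> U" for e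
    using uM pM[OF that] u p[OF that]
    by (intro past_weight_integrable[OF h, of _ 1]) (auto simp: abs_mult intro!: mult_le_one)
  have ix: "integrable M (\<lambda>\<omega>. h \<omega> * (x e * unselected t e \<omega>))" if "e \<in> U" for e
    using uM u x_range[OF that]
    by (intro past_weight_integrable[OF h, of _ 1]) (auto simp: abs_mult intro!: mult_le_one)
  show "integrable M (\<lambda>\<omega>. h \<omega> * rest_p t \<omega>)" "integrable M (\<lambda>\<omega>. h \<omega> * rest_x t \<omega>)"
    "(\<integral>\<omega>. h \<omega> * rest_p t \<omega> \<partial>M) = (\<Sum>e\<in>U. a e * (\<integral>\<omega>. h \<omega> * (p t e \<omega> * unselected t e \<omega>) \<partial>M))"
    unfolding rest_p_def rest_x_def
    using integral_weighted_sum[OF ip] integral_weighted_sum[OF ix] by auto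
  have "(\<integral>\<omega>. h \<omega> * rest_x t \<omega> \<partial>M) = (\<Sum>e\<in>U. a e * (\<integral>\<omega>. h \<omega> * (x e * unselected t e \<omega>) \<partial>M))"
    unfolding rest_x_def using integral_weighted_sum[OF ix] by auto
  then show "(\<integral>\<omega>. h \<omega> * rest_x t \<omega> \<partial>M) = (\<Sum>e\<in>U. a e * (x e * (\<integral>\<omega>. h \<omega> * unselected t e \<omega> \<partial>M)))"
    by (simp add: mult.left_commute[of "h _" "x _"])
qed

text \<open>Per remaining element, and up to the factor \<open>1 / m\<close>, acceptance brings at
  least \<open>p\<close>, the departure of the arriving element costs \<open>c * p\<close> and
  returns \<open>c * \<kappa> * x\<close>, and the reduction of \<open>p\<close> costs at most
  \<open>c * lam * x\<close>.\<close>

lemma integral_increment_ge: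
  assumes t: "t \<in> {1..card U}" and h: "past_weight t h" and c: "0 \<le> c"
  defines "m \<equiv> real (card U) - real t + 1"
  shows "integrable M (\<lambda>\<omega>. h \<omega> * increment t c \<kappa> \<omega>)"
    and "(\<integral>\<omega>. h \<omega> * increment t c \<kappa> \<omega> \<partial>M) \<ge>
      (\<integral>\<omega>. h \<omega> * (((1 - c) * rest_p t \<omega> - c * (lam - \<kappa>) * rest_x t \<omega>) / m) \<partial>M)"
proof -
  note contrib = integral_contribution[OF t _ h]
  show "integrable M (\<lambda>\<omega>. h \<omega> * increment t c \<kappa> \<omega>)"
    unfolding increment_def by (intro integral_weighted_sum contrib)
  let ?p = "\<lambda>e. \<integral>\<omega>. h \<omega> * (p t e \<omega> * unselected t e \<omega>) \<partial>M"
  let ?u = "\<lambda>e. \<integral>\<omega>. h \<omega> * unselected t e \<omega> \<partial>M"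
  have "(\<integral>\<omega>. h \<omega> * (((1 - c) * rest_p t \<omega> - c * (lam - \<kappa>) * rest_x t \<omega>) / m) \<partial>M) =
      (\<integral>\<omega>. (1 - c) / m * (h \<omega> * rest_p t \<omega>) - c * (lam - \<kappa>) / m * (h \<omega> * rest_x t \<omega>) \<partial>M)"
    by (intro Bochner_Integration.integral_cong) (auto simp: field_simps add_divide_distrib diff_divide_distrib)
  also have "\<dots> = (1 - c) / m * (\<Sum>e\<in>U. a e * ?p e) - c * (lam - \<kappa>) / m * (\<Sum>e\<in>U. a e * (x e * ?u e))"
    using integral_rest[OF t h] by simp
  also have "\<dots> = (\<Sum>e\<in>U. a e * ((1 - c) / m * ?p e + c * \<kappa> * x e / m * ?u e - c * (lam * x e / m * ?u e)))"
    by (simp add: sum_distrib_left sum_subtractf[symmetric], intro sum.cong)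
      (auto simp: algebra_simps add_divide_distrib diff_divide_distrib)
  also have "\<dots> \<le> (\<Sum>e\<in>U. a e * (\<integral>\<omega>. h \<omega> * (select t e \<omega> * X t e \<omega> + (- c) * (p t e \<omega> * select t e \<omega>) +
      c * \<kappa> * x e * select t e \<omega> + (- c) * (unselected t e \<omega> * \<Delta> t e \<omega>)) \<partial>M))"
  proof (intro sum_mono mult_left_mono)
    fix e assume e: "e \<in> U"
    have hp: "past_weight t (\<lambda>\<omega>. h \<omega> * p t e \<omega>)"
      using h e t by (intro past_weight_mult past_weight_p) auto
    have "1 / m * ?p e = (\<integral>\<omega>. h \<omega> * (select t e \<omega> * p t e \<omega>) \<partial>M)"
      using integral_select[OF t e hp] by (simp add: m_def ac_simps)
    also note integral_select_X_ge[OF t e h]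
    finally have X: "1 / m * ?p e \<le> (\<integral>\<omega>. h \<omega> * (select t e \<omega> * X t e \<omega>) \<partial>M)" .
    \<comment> \<open>With this weight the bound on \<open>\<Delta>\<close> is charged only for
      elements still to arrive, which yields \<open>rest_x\<close> instead of the full sum.\<close>
    have hu: "past_weight t (\<lambda>\<omega>. h \<omega> * unselected t e \<omega>)"
      using h t by (intro past_weight_mult past_weight_unselected) auto
    have "(\<integral>\<omega>. h \<omega> * (unselected t e \<omega> * \<Delta> t e \<omega>) \<partial>M) \<le> lam * x e / m * ?u e"
      using integral_\<Delta>_le[OF t e hu] by (simp add: m_def ac_simps)
    from X mult_left_mono[OF this c]
    show "(1 - c) / m * ?p e + c * \<kappa> * x e / m * ?u e - c * (lam * x e / m * ?u e) \<le>
        (\<integral>\<omega>. h \<omega> * (select t e \<omega> * X t e \<omega> + (- c) * (p t e \<omega> * select t e \<omega>) +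
      c * \<kappa> * x e * select t e \<omega> + (- c) * (unselected t e \<omega> * \<Delta> t e \<omega>)) \<partial>M)"
      unfolding contrib(2)[OF e] m_def[symmetric] by (simp add: diff_divide_distrib left_diff_distrib)
  qed (use a in auto)
  also have "\<dots> = (\<integral>\<omega>. h \<omega> * increment t c \<kappa> \<omega> \<partial>M)"
    unfolding increment_def by (intro integral_weighted_sum(2)[symmetric] contrib)
  finally show "(\<integral>\<omega>. h \<omega> * increment t c \<kappa> \<omega> \<partial>M) \<ge>
      (\<integral>\<omega>. h \<omega> * (((1 - c) * rest_p t \<omega> - c * (lam - \<kappa>) * rest_x t \<omega>) / m) \<partial>M)" .
qed

text \<open>Each of the four terms has mean at most a multiple of \<open>x e / m\<close> on the
  elements still to arrive; the multiples are 1, \<open>c\<close> (by \<open>p \<le> x\<close>),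
  \<open>c * \<kappa>\<close> and \<open>c * lam\<close>.\<close>

lemma integral_abs_increment_le:
  assumes t: "t \<in> {1..card U}" and h: "past_weight t h" and c: "0 \<le> c"
  defines "m \<equiv> real (card U) - real t + 1"
  shows "integrable M (\<lambda>\<omega>. h \<omega> * abs_increment t c \<kappa> \<omega>)"
    and "(\<integral>\<omega>. h \<omega> * abs_increment t c \<kappa> \<omega> \<partial>M) \<le>
      (1 + c + c * \<kappa> + c * lam) / m * (\<integral>\<omega>. h \<omega> * rest_x t \<omega> \<partial>M)"
proof -
  note contrib = integral_contribution[OF t _ h]
  show "integrable M (\<lambda>\<omega>. h \<omega> * abs_increment t c \<kappa> \<omega>)"
    unfolding abs_increment_def by (intro integral_weighted_sum contrib)
  let ?p = "\<lambda>e. \<integral>\<omega>. h \<omega> * (p t e \<omega> * unselected t e \<omega>) \<partial>M"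
  let ?u = "\<lambda>e. \<integral>\<omega>. h \<omega> * unselected t e \<omega> \<partial>M"
  have "(\<integral>\<omega>. h \<omega> * abs_increment t c \<kappa> \<omega> \<partial>M) =
      (\<Sum>e\<in>U. a e * (\<integral>\<omega>. h \<omega> * (select t e \<omega> * X t e \<omega> + c * (p t e \<omega> * select t e \<omega>) +
      c * \<kappa> * x e * select t e \<omega> + c * (unselected t e \<omega> * \<Delta> t e \<omega>)) \<partial>M))"
    unfolding abs_increment_def by (intro integral_weighted_sum(2) contrib)
  also have "\<dots> \<le> (\<Sum>e\<in>U. a e * ((1 + c + c * \<kappa> + c * lam) / m * (x e * ?u e)))"
  proof (intro sum_mono mult_left_mono)
    fix e assume e: "e \<in> U"
    have m: "m > 0" using t by (auto simp: m_def)
    have X: "(\<integral>\<omega>. h \<omega> * (select t e \<omega> * X t e \<omega>) \<partial>M) \<le> x e * ?u e / m"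
      using integral_select_X_le[OF t e h] integral_select[OF t e h] by (simp add: m_def)
    have hu: "past_weight t (\<lambda>\<omega>. h \<omega> * unselected t e \<omega>)"
      using h t by (intro past_weight_mult past_weight_unselected) auto
    have uM: "unselected t e \<in> borel_measurable M" and pM: "p t e \<in> borel_measurable M"
      using measurable_F_M[OF unselected_measurable[of t e]]
        measurable_F_M[OF p_measurable[of t e]] t e by auto
    have u: "\<bar>unselected t e \<omega>\<bar> \<le> 1" for \<omega>
      using unselected_range[of t e \<omega>] by auto
    have p: "\<bar>p t e \<omega>\<bar> \<le> 1" if "\<omega> \<in> space M" for \<omega>
      using p_range[of t e \<omega>] x_range[of e] t e that by auto
    have "?p e \<le> (\<integral>\<omega>. h \<omega> * (x e * unselected t e \<omega>) \<partial>M)"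
    proof (rule integral_mono)
      show "integrable M (\<lambda>\<omega>. h \<omega> * (p t e \<omega> * unselected t e \<omega>))"
        using uM pM u p by (intro past_weight_integrable[OF h, of _ 1]) (auto simp: abs_mult intro!: mult_le_one)
      show "integrable M (\<lambda>\<omega>. h \<omega> * (x e * unselected t e \<omega>))"
        using uM u x_range[OF e]
        by (intro past_weight_integrable[OF h, of _ 1]) (auto simp: abs_mult intro!: mult_le_one)
      show "h \<omega> * (p t e \<omega> * unselected t e \<omega>) \<le> h \<omega> * (x e * unselected t e \<omega>)"
        if "\<omega> \<in> space M" for \<omega>
        using p_range[of t e \<omega>] t e that past_weight_nonneg[OF h that] unselected_range
        by (intro mult_left_mono mult_right_mono) auto
    qed
    then have P: "?p e / m \<le> x e * ?u e / m"
      using m by (simp add: mult.left_commute[of "h _" "x _"] divide_right_mono)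
    have "(\<integral>\<omega>. h \<omega> * (unselected t e \<omega> * \<Delta> t e \<omega>) \<partial>M) \<le> lam * x e / m * ?u e"
      using integral_\<Delta>_le[OF t e hu] by (simp add: m_def ac_simps)
    from X mult_left_mono[OF P c] mult_left_mono[OF this c]
    show "(\<integral>\<omega>. h \<omega> * (select t e \<omega> * X t e \<omega> + c * (p t e \<omega> * select t e \<omega>) +
        c * \<kappa> * x e * select t e \<omega> + c * (unselected t e \<omega> * \<Delta> t e \<omega>)) \<partial>M) \<le>
        (1 + c + c * \<kappa> + c * lam) / m * (x e * ?u e)"
      unfolding contrib(2)[OF e] m_def[symmetric]
      by (simp add: algebra_simps add_divide_distrib)
  qed (use a in auto)
  also have "\<dots> = (1 + c + c * \<kappa> + c * lam) / m * (\<integral>\<omega>. h \<omega> * rest_x t \<omega> \<partial>M)"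
    unfolding integral_rest(4)[OF t h] by (simp add: sum_distrib_left ac_simps)
  finally show "(\<integral>\<omega>. h \<omega> * abs_increment t c \<kappa> \<omega> \<partial>M) \<le>
      (1 + c + c * \<kappa> + c * lam) / m * (\<integral>\<omega>. h \<omega> * rest_x t \<omega> \<partial>M)" .
qed

text \<open>Only one element arrives in a step, so the first three terms add up to at most
  \<open>1 + c + c * \<kappa>\<close>. The last one is where the process being limited
  enters.\<close>

lemma abs_increment_bounds:
  assumes t: "t \<in> {1..card U}" and \<omega>: "\<omega> \<in> space M" and c: "0 \<le> c" "0 \<le> \<kappa>"
  shows "\<bar>increment t c \<kappa> \<omega>\<bar> \<le> abs_increment t c \<kappa> \<omega>"
    and "abs_increment t c \<kappa> \<omega> \<le> 1 + c + c * \<kappa> + c * lam"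
proof -
  have X: "0 \<le> X t e \<omega>" "X t e \<omega> \<le> 1" and p: "0 \<le> p t e \<omega>" "p t e \<omega> \<le> 1"
    and x: "0 \<le> x e" "x e \<le> 1" and \<Delta>: "0 \<le> \<Delta> t e \<omega>" if "e \<in> U" for e
    using X_bounds(1)[OF _ that \<omega>, of t] p_range[OF _ that \<omega>, of t] x_range[OF that]
      \<Delta>_range[OF t that \<omega>] t by auto
  show "\<bar>increment t c \<kappa> \<omega>\<bar> \<le> abs_increment t c \<kappa> \<omega>"
    unfolding increment_def abs_increment_def
  proof (rule order_trans[OF sum_abs], intro sum_mono)
    fix e assume e: "e \<in> U"
    have "0 \<le> select t e \<omega> * X t e \<omega>" "0 \<le> c * (p t e \<omega> * select t e \<omega>)"
      "0 \<le> c * \<kappa> * x e * select t e \<omega>" "0 \<le> c * (unselected t e \<omega> * \<Delta> t e \<omega>)"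
      using X[OF e] p[OF e] x[OF e] \<Delta>[OF e] c unselected_range by auto
    then show "\<bar>a e * (select t e \<omega> * X t e \<omega> + - c * (p t e \<omega> * select t e \<omega>) +
        c * \<kappa> * x e * select t e \<omega> + - c * (unselected t e \<omega> * \<Delta> t e \<omega>))\<bar> \<le>
      a e * (select t e \<omega> * X t e \<omega> + c * (p t e \<omega> * select t e \<omega>) +
        c * \<kappa> * x e * select t e \<omega> + c * (unselected t e \<omega> * \<Delta> t e \<omega>))"
      unfolding abs_mult using a[OF e] by (simp only: abs_of_nonneg atLeastAtMost_iff, intro mult_left_mono) auto
  qed
  have "abs_increment t c \<kappa> \<omega> \<le> (\<Sum>e\<in>U. (1 + c + c * \<kappa>) * select t e \<omega> + c * \<bar>\<Delta> t e \<omega>\<bar>)"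
    unfolding abs_increment_def
  proof (intro sum_mono)
    fix e assume e: "e \<in> U"
    let ?s = "select t e \<omega> * X t e \<omega> + c * (p t e \<omega> * select t e \<omega>) +
      c * \<kappa> * x e * select t e \<omega> + c * (unselected t e \<omega> * \<Delta> t e \<omega>)"
    have "0 \<le> ?s"
      using X[OF e] p[OF e] x[OF e] \<Delta>[OF e] c unselected_range by auto
    then have "a e * ?s \<le> ?s"
      using a[OF e] mult_right_mono[of "a e" 1 ?s] by auto
    also have "select t e \<omega> * X t e \<omega> \<le> select t e \<omega> * 1"
      using X[OF e] by (intro mult_left_mono) auto
    also have "c * (p t e \<omega> * select t e \<omega>) \<le> c * (1 * select t e \<omega>)"
      using p[OF e] c by (intro mult_left_mono mult_right_mono) auto
    also have "c * \<kappa> * x e * select t e \<omega> \<le> c * \<kappa> * 1 * select t e \<omega>"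
      using x[OF e] c by (intro mult_left_mono mult_right_mono) auto
    also have "c * (unselected t e \<omega> * \<Delta> t e \<omega>) \<le> c * (1 * \<bar>\<Delta> t e \<omega>\<bar>)"
      using \<Delta>[OF e] c unselected_range by (intro mult_left_mono mult_mono) auto
    finally show "a e * ?s \<le> (1 + c + c * \<kappa>) * select t e \<omega> + c * \<bar>\<Delta> t e \<omega>\<bar>"
      by (simp add: algebra_simps)
  qed
  also have "\<dots> = (1 + c + c * \<kappa>) + c * (\<Sum>e\<in>U. \<bar>\<Delta> t e \<omega>\<bar>)"
    using sum_select[OF t \<omega>, of "\<lambda>_. 1 + c + c * \<kappa>"] by (simp add: sum.distrib sum_distrib_left)
  also have "\<dots> \<le> 1 + c + c * \<kappa> + c * lam"
    using limited[OF t \<omega>] c by (simp add: mult_left_mono)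
  finally show "abs_increment t c \<kappa> \<omega> \<le> 1 + c + c * \<kappa> + c * lam" .
qed

section \<open>The potential and its exponential moment\<close>

text \<open>The submartingale \<open>G\<close> of the overview after step \<open>t\<close>, with its
  coefficient as a parameter: a step is analysed with \<open>c\<close> frozen, and the change of
  \<open>c\<close> is accounted for separately.\<close>

definition potential :: "nat \<Rightarrow> real \<Rightarrow> real \<Rightarrow> 'w \<Rightarrow> real" where
  "potential t c \<kappa> \<omega> = gain t \<omega> + c * (rest_p (t + 1) \<omega> - \<kappa> * rest_x (t + 1) \<omega>)"

text \<open>A deterministic lower bound, needed to make the exponential of the negated potential a
  bounded weight.\<close>

lemma potential_ge:
  assumes "t \<le> card U" "\<omega> \<in> space M" "0 \<le> c" "0 \<le> \<kappa>"
  shows "potential t c \<kappa> \<omega> \<ge> - (c * (\<kappa> * (\<Sum>e\<in>U. a e * x e)))"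
proof -
  have "c * (\<kappa> * rest_x (t + 1) \<omega>) \<le> c * (\<kappa> * (\<Sum>e\<in>U. a e * x e))"
    using assms rest_x_le by (intro mult_left_mono) auto
  moreover have "0 \<le> c * rest_p (t + 1) \<omega>"
    using assms rest_p_nonneg[of "t + 1" \<omega>] by simp
  ultimately show ?thesis
    using gain_nonneg[OF assms(1,2)] by (simp add: potential_def right_diff_distrib)
qed

lemma potential_measurable:
  "t \<le> card U \<Longrightarrow> potential t c \<kappa> \<in> borel_measurable (F t)"
  unfolding potential_def using gain_measurable[of t] rest_p_measurable[of "t + 1"]
    rest_x_measurable[of "t + 1"] by simp

lemma past_weight_exp_potential:
  assumes "t \<le> card U" "0 \<le> c" "0 \<le> \<kappa>" "0 \<le> \<theta>"
  shows "past_weight (t + 1) (\<lambda>\<omega>. exp (- \<theta> * potential t c \<kappa> \<omega>))"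
proof -
  have "exp (- \<theta> * potential t c \<kappa> \<omega>) \<le> exp (\<theta> * (c * (\<kappa> * (\<Sum>e\<in>U. a e * x e))))"
    if "\<omega> \<in> space M" for \<omega>
    using mult_left_mono[OF potential_ge[OF assms(1) that assms(2,3)] assms(4)] by simp
  then show ?thesis
    unfolding past_weight_def using potential_measurable[OF assms(1)] by auto
qed

text \<open>The surplus is \<open>c\<close> times the weighted \<open>\<Delta> t\<close> of the
  arriving element, which leaves \<open>Y\<close> with all of its \<open>p\<close> anyway and which
  \<open>increment\<close> charges for \<open>\<Delta>\<close> in addition.\<close>

lemma potential_step:
  assumes t: "t \<in> {1..card U}" and \<omega>: "\<omega> \<in> space M" and c: "0 \<le> c"
  shows "potential t c \<kappa> \<omega> \<ge> potential (t - 1) c \<kappa> \<omega> + increment t c \<kappa> \<omega>"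
proof -
  have "potential (t - 1) c \<kappa> \<omega> + increment t c \<kappa> \<omega> = (\<Sum>e\<in>U. a e * (X (t - 1) e \<omega> +
      c * (p t e \<omega> * unselected t e \<omega>) - c * \<kappa> * (x e * unselected t e \<omega>) +
      (select t e \<omega> * X t e \<omega> + (- c) * (p t e \<omega> * select t e \<omega>) +
      c * \<kappa> * x e * select t e \<omega> + (- c) * (unselected t e \<omega> * \<Delta> t e \<omega>))))"
    using t unfolding potential_def gain_def rest_p_def rest_x_def increment_def
    by (simp add: sum_distrib_left right_diff_distrib sum.distrib[symmetric] sum_subtractf[symmetric])
      (intro sum.cong, auto simp: algebra_simps)
  also have "\<dots> \<le> (\<Sum>e\<in>U. a e * (X t e \<omega> + c * (p (t + 1) e \<omega> * unselected (t + 1) e \<omega>) -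
      c * \<kappa> * (x e * unselected (t + 1) e \<omega>)))"
  proof (intro sum_mono mult_left_mono)
    fix e assume e: "e \<in> U"
    \<comment> \<open>Stated over plain variables, the identity groups the terms so that the three
      update rules apply from right to left and only the surplus \<open>c * (s * d)\<close> is left
      over.\<close>
    have expand: "y\<^sub>0 + c * (q * u) - c * \<kappa> * (z * u) + (s * y + (- c) * (q * s) + c * \<kappa> * z * s + (- c) * (u * d)) =
        (y\<^sub>0 + s * y) + c * ((q - d) * (u - s)) - c * \<kappa> * (z * (u - s)) - c * (s * d)"
      for y\<^sub>0 q u z s y d :: real
      by (simp add: algebra_simps)
    have "0 \<le> c * (select t e \<omega> * \<Delta> t e \<omega>)"
      using c \<Delta>_range[OF t e \<omega>] by simp
    then show "X (t - 1) e \<omega> +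
      c * (p t e \<omega> * unselected t e \<omega>) - c * \<kappa> * (x e * unselected t e \<omega>) +
      (select t e \<omega> * X t e \<omega> + (- c) * (p t e \<omega> * select t e \<omega>) +
      c * \<kappa> * x e * select t e \<omega> + (- c) * (unselected t e \<omega> * \<Delta> t e \<omega>)) \<le>
      X t e \<omega> + c * (p (t + 1) e \<omega> * unselected (t + 1) e \<omega>) -
      c * \<kappa> * (x e * unselected (t + 1) e \<omega>)"
      unfolding expand X_step[OF t e \<omega>, symmetric] p_step[OF t e \<omega>, symmetric]
        unselected_Suc[OF t \<omega>, symmetric] by simp
  qed (use a in auto)
  also have "\<dots> = potential t c \<kappa> \<omega>"
    unfolding potential_def gain_def rest_p_def rest_x_def
    by (simp add: sum_distrib_left right_diff_distrib sum.distrib[symmetric] sum_subtractf[symmetric])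
      (intro sum.cong, auto simp: algebra_simps)
  finally show ?thesis .
qed

text \<open>When the coefficient drops from \<open>c + (1 - c) / m\<close> to \<open>c\<close>, the conditional drift of the potential
  is at least \<open>(\<kappa> - lam * c) * rest_x t / m\<close>, hence nonnegative.\<close>

lemma integral_exp_potential_step:
  assumes t: "t \<in> {1..card U}"
    and c: "0 \<le> c" "c \<le> 1/2" "c * (lam + 1) \<le> 1" "lam * c \<le> \<kappa>" and \<kappa>: "0 \<le> \<kappa>" "\<kappa> \<le> 1/2"
    and \<theta>: "0 \<le> \<theta>" "\<theta> \<le> 1/3"
  defines "m \<equiv> real (card U) - real t + 1" and "W \<equiv> (\<Sum>e\<in>U. a e * x e)"
  shows "(\<integral>\<omega>. exp (- \<theta> * potential t c \<kappa> \<omega>) \<partial>M) \<le>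
    exp (6 * \<theta>\<^sup>2 * W / m) * (\<integral>\<omega>. exp (- \<theta> * potential (t - 1) (c + (1 - c) / m) \<kappa> \<omega>) \<partial>M)"
proof -
  \<comment> \<open>The weight uses the coefficient \<open>c\<close> from after the step already
    before it; the passage to the larger \<open>c'\<close> is made pointwise further down.\<close>
  define h where "h = (\<lambda>\<omega>. exp (- \<theta> * potential (t - 1) c \<kappa> \<omega>))"
  define V where "V = increment t c \<kappa>"
  define N where "N = abs_increment t c \<kappa>"
  define \<beta> where "\<beta> = (\<lambda>\<omega>. ((1 - c) * rest_p t \<omega> - c * (lam - \<kappa>) * rest_x t \<omega>) / m)"
  define c' where "c' = c + (1 - c) / m"
  have m: "m \<ge> 1" using t by (auto simp: m_def)
  have t': "t - 1 \<le> card U" "t - 1 + 1 = t" using t by auto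
  have h: "past_weight t h"
    unfolding h_def using past_weight_exp_potential[OF t'(1) c(1) \<kappa>(1) \<theta>(1)] t' by simp
  have c'0: "0 \<le> c'" using c m by (simp add: c'_def)
  define b where "b = 1 + c + c * \<kappa> + c * lam"
  have "c * \<kappa> \<le> 1/2 * (1/2)"
    using c \<kappa> by (intro mult_mono) auto
  then have "b \<le> 9/4"
    using c by (simp add: b_def algebra_simps)
  \<comment> \<open>\<open>lam\<close> comes without a sign here; \<open>b\<close> is nonnegative
    because it bounds an absolute value at any point of the space. The upper bound 9/4 is 1 + 1 +
    1/4.\<close>
  moreover obtain \<omega>\<^sub>0 where "\<omega>\<^sub>0 \<in> space M"
    using not_empty by auto
  then have "0 \<le> b"
    using abs_increment_bounds[OF t _ c(1) \<kappa>(1), of \<omega>\<^sub>0] by (simp add: b_def)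
  ultimately have b: "b \<le> 9/4" "0 \<le> b" by auto
  note V = integral_increment_ge[OF t h c(1), of \<kappa>, folded V_def m_def]
  note N = integral_abs_increment_le[OF t h c(1), of \<kappa>, folded N_def m_def b_def]
  note rest = integral_rest[OF t h]
  have int_h: "integrable M h"
    using past_weight_integrable[OF h, of "\<lambda>_. 1" 1] by simp
  have pw: "integrable M (\<lambda>\<omega>. exp (- \<theta> * potential s d \<kappa> \<omega>))" if "s \<le> card U" "0 \<le> d" for s d
    using past_weight_integrable[OF past_weight_exp_potential[OF that \<kappa>(1) \<theta>(1)], of "\<lambda>_. 1" 1] by simp
  have int_\<beta>: "integrable M (\<lambda>\<omega>. h \<omega> * \<beta> \<omega>)"
  proof -
    have "integrable M (\<lambda>\<omega>. (1 - c) / m * (h \<omega> * rest_p t \<omega>) - c * (lam - \<kappa>) / m * (h \<omega> * rest_x t \<omega>))"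
      using rest by (intro Bochner_Integration.integrable_diff integrable_mult_right)
    also have "(\<lambda>\<omega>. (1 - c) / m * (h \<omega> * rest_p t \<omega>) - c * (lam - \<kappa>) / m * (h \<omega> * rest_x t \<omega>)) =
        (\<lambda>\<omega>. h \<omega> * \<beta> \<omega>)"
      by (auto simp: \<beta>_def fun_eq_iff algebra_simps diff_divide_distrib add_divide_distrib)
    finally show ?thesis .
  qed
  have pos: "0 \<le> h \<omega>" for \<omega> by (simp add: h_def)
  have "(\<integral>\<omega>. exp (- \<theta> * potential t c \<kappa> \<omega>) \<partial>M) \<le>
      (\<integral>\<omega>. h \<omega> - \<theta> * (h \<omega> * V \<omega>) + 9/4 * \<theta>\<^sup>2 * (h \<omega> * N \<omega>) \<partial>M)"
  proof (rule integral_mono)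
    show "integrable M (\<lambda>\<omega>. exp (- \<theta> * potential t c \<kappa> \<omega>))"
      using pw c t by auto
    show "integrable M (\<lambda>\<omega>. h \<omega> - \<theta> * (h \<omega> * V \<omega>) + 9/4 * \<theta>\<^sup>2 * (h \<omega> * N \<omega>))"
      using V(1) N(1) int_h
      by (intro Bochner_Integration.integrable_diff Bochner_Integration.integrable_add integrable_mult_right)
    fix \<omega> assume \<omega>: "\<omega> \<in> space M"
    note bd = abs_increment_bounds[OF t \<omega> c(1) \<kappa>(1), folded V_def N_def b_def]
    have VN: "\<bar>V \<omega>\<bar> \<le> N \<omega>" "N \<omega> \<le> 9/4"
      using bd b by auto
    \<comment> \<open>The value 3/4 is below 1, the range of the quadratic estimate.\<close>
    have "\<bar>\<theta> * V \<omega>\<bar> \<le> 1/3 * (9/4)"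
      unfolding abs_mult using \<theta> VN by (intro mult_mono) auto
    then have "exp (- (\<theta> * V \<omega>)) \<le> 1 - \<theta> * V \<omega> + (\<theta> * V \<omega>)\<^sup>2"
      by (intro exp_minus_le_quadratic) auto
    also have "(\<theta> * V \<omega>)\<^sup>2 = \<theta>\<^sup>2 * (\<bar>V \<omega>\<bar> * \<bar>V \<omega>\<bar>)"
      by (simp add: power_mult_distrib power2_eq_square)
    \<comment> \<open>One factor is bounded by a constant and the other kept as \<open>N\<close>,
      whose mean is of order \<open>rest_x t / m\<close>. Hence the second-order loss scales with
      \<open>W / m\<close> and not with the number of steps.\<close>
    also have "\<dots> \<le> \<theta>\<^sup>2 * (9/4 * N \<omega>)"
      using VN by (intro mult_left_mono mult_mono) auto
    finally have exp: "exp (- (\<theta> * V \<omega>)) \<le> 1 - \<theta> * V \<omega> + \<theta>\<^sup>2 * (9/4 * N \<omega>)" by simp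
    have "exp (- \<theta> * potential t c \<kappa> \<omega>) \<le> exp (- \<theta> * (potential (t - 1) c \<kappa> \<omega> + V \<omega>))"
      using mult_left_mono[OF potential_step[OF t \<omega> c(1), of \<kappa>] \<theta>(1)] by (simp add: V_def)
    also have "\<dots> = h \<omega> * exp (- (\<theta> * V \<omega>))"
      by (simp add: h_def algebra_simps flip: exp_add)
    also have "\<dots> \<le> h \<omega> * (1 - \<theta> * V \<omega> + \<theta>\<^sup>2 * (9/4 * N \<omega>))"
      using exp pos by (rule mult_left_mono)
    finally show "exp (- \<theta> * potential t c \<kappa> \<omega>) \<le>
        h \<omega> - \<theta> * (h \<omega> * V \<omega>) + 9/4 * \<theta>\<^sup>2 * (h \<omega> * N \<omega>)"
      by (simp add: algebra_simps)
  qed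
  also have "\<dots> = (\<integral>\<omega>. h \<omega> \<partial>M) - \<theta> * (\<integral>\<omega>. h \<omega> * V \<omega> \<partial>M) + 9/4 * \<theta>\<^sup>2 * (\<integral>\<omega>. h \<omega> * N \<omega> \<partial>M)"
    using V(1) N(1) int_h by simp
  also have "\<dots> \<le> (\<integral>\<omega>. h \<omega> \<partial>M) - \<theta> * (\<integral>\<omega>. h \<omega> * \<beta> \<omega> \<partial>M) +
      9/4 * \<theta>\<^sup>2 * (b / m * (\<integral>\<omega>. h \<omega> * rest_x t \<omega> \<partial>M))"
    using V(2) N(2) \<theta> unfolding \<beta>_def by (intro add_mono diff_mono mult_left_mono order_refl) auto
  also have "\<dots> = (\<integral>\<omega>. h \<omega> - \<theta> * (h \<omega> * \<beta> \<omega>) + 9/4 * \<theta>\<^sup>2 * b / m * (h \<omega> * rest_x t \<omega>) \<partial>M)"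
    using int_h int_\<beta> rest by simp
  also have "\<dots> \<le> (\<integral>\<omega>. exp (6 * \<theta>\<^sup>2 * W / m) * exp (- \<theta> * potential (t - 1) c' \<kappa> \<omega>) \<partial>M)"
  proof (rule integral_mono)
    show "integrable M (\<lambda>\<omega>. h \<omega> - \<theta> * (h \<omega> * \<beta> \<omega>) + 9/4 * \<theta>\<^sup>2 * b / m * (h \<omega> * rest_x t \<omega>))"
      using int_h int_\<beta> rest
      by (intro Bochner_Integration.integrable_diff Bochner_Integration.integrable_add integrable_mult_right)
    show "integrable M (\<lambda>\<omega>. exp (6 * \<theta>\<^sup>2 * W / m) * exp (- \<theta> * potential (t - 1) c' \<kappa> \<omega>))"
      using pw[OF t'(1) c'0] by (rule integrable_mult_right)
    fix \<omega> assume \<omega>: "\<omega> \<in> space M"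
    have "9/4 * \<theta>\<^sup>2 * b / m * rest_x t \<omega> \<le> 9/4 * \<theta>\<^sup>2 * (9/4) / m * W"
      using b m rest_x_le[of t \<omega>] rest_x_nonneg[of t \<omega>]
      by (intro mult_mono divide_right_mono mult_left_mono) (auto simp: W_def)
    \<comment> \<open>The constant 6 rounds up (9/4) * (9/4) = 81/16.\<close>
    also have "\<dots> \<le> 6 * \<theta>\<^sup>2 * W / m"
      using m order_trans[OF rest_x_nonneg[of t \<omega>] rest_x_le[of t \<omega>], folded W_def]
      by (simp add: field_simps)
    finally have Z: "9/4 * \<theta>\<^sup>2 * b / m * rest_x t \<omega> \<le> 6 * \<theta>\<^sup>2 * W / m" .
    \<comment> \<open>\<open>c'\<close> is chosen so that the terms in \<open>rest_p\<close> cancel;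
      the sign of what remains is the hypothesis \<open>lam * c \<le> \<kappa>\<close>.\<close>
    have "(c' - c) * (rest_p t \<omega> - \<kappa> * rest_x t \<omega>) - \<beta> \<omega> = (lam * c - \<kappa>) * rest_x t \<omega> / m"
      by (simp add: c'_def \<beta>_def algebra_simps add_divide_distrib diff_divide_distrib)
    also have "\<dots> \<le> 0"
      using c(4) m rest_x_nonneg[of t \<omega>] by (intro divide_nonpos_pos mult_nonpos_nonneg) auto
    finally have drift: "(c' - c) * (rest_p t \<omega> - \<kappa> * rest_x t \<omega>) \<le> \<beta> \<omega>" by simp
    have "potential (t - 1) c' \<kappa> \<omega> \<le> potential (t - 1) c \<kappa> \<omega> + \<beta> \<omega>"
      using drift t' by (simp add: potential_def algebra_simps)
    note pot = mult_left_mono[OF this \<theta>(1)]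
    have "h \<omega> - \<theta> * (h \<omega> * \<beta> \<omega>) + 9/4 * \<theta>\<^sup>2 * b / m * (h \<omega> * rest_x t \<omega>) =
        h \<omega> * (1 + (- \<theta> * \<beta> \<omega> + 9/4 * \<theta>\<^sup>2 * b / m * rest_x t \<omega>))"
      by (simp add: algebra_simps)
    also have "\<dots> \<le> h \<omega> * exp (- \<theta> * \<beta> \<omega> + 9/4 * \<theta>\<^sup>2 * b / m * rest_x t \<omega>)"
      using pos by (intro mult_left_mono exp_ge_add_one_self)
    also have "\<dots> = exp (- \<theta> * potential (t - 1) c \<kappa> \<omega> - \<theta> * \<beta> \<omega> + 9/4 * \<theta>\<^sup>2 * b / m * rest_x t \<omega>)"
      by (simp add: h_def flip: exp_add)
    also have "\<dots> \<le> exp (6 * \<theta>\<^sup>2 * W / m + - \<theta> * potential (t - 1) c' \<kappa> \<omega>)"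
      using Z pot by (simp only: exp_le_cancel_iff) (simp add: algebra_simps)
    finally show "h \<omega> - \<theta> * (h \<omega> * \<beta> \<omega>) + 9/4 * \<theta>\<^sup>2 * b / m * (h \<omega> * rest_x t \<omega>) \<le>
        exp (6 * \<theta>\<^sup>2 * W / m) * exp (- \<theta> * potential (t - 1) c' \<kappa> \<omega>)"
      by (simp only: exp_add)
  qed
  finally show ?thesis by (simp add: c'_def)
qed

text \<open>Iterates the one-step estimate \<open>k\<close> times. The coefficient ends at 0, where
  the potential is the gain itself, and starts at \<open>k / n\<close>, where it is a
  constant.\<close>

lemma integral_exp_gain_le:
  assumes k: "k < card U" and lam: "lam \<ge> 1" and \<theta>: "0 \<le> \<theta>" "\<theta> \<le> 1/3"
    and \<kappa>: "\<kappa> = lam * (real k / real (card U))" "\<kappa> \<le> 1/2"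
  defines "W \<equiv> (\<Sum>e\<in>U. a e * x e)"
  shows "(\<integral>\<omega>. exp (- \<theta> * gain k \<omega>) \<partial>M) \<le>
    exp (6 * \<theta>\<^sup>2 * W / lam - \<theta> * (real k / real (card U) * (1 - \<kappa>) * W))"
proof -
  let ?n = "real (card U)"
  \<comment> \<open>The solution of \<open>c (t - 1) = c t + (1 - c t) / (n - t + 1)\<close> with
    \<open>c k = 0\<close>, where \<open>n\<close> is \<open>card U\<close>; equivalently
    \<open>1 - c t = (n - k) / (n - t)\<close>.\<close>
  define c where "c t = (real k - real t) / (?n - real t)" for t
  have W: "W \<ge> 0"
    unfolding W_def using a x_range by (intro sum_nonneg mult_nonneg_nonneg) auto
  have n: "?n > 0" "real k < ?n" using k by auto
  have \<kappa>0: "0 \<le> \<kappa>" using \<kappa> lam by simp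
  have kn: "2 * (lam * real k) \<le> ?n"
    using \<kappa>(2) n by (simp add: \<kappa>(1) field_simps)
  have lamk: "real k \<le> lam * real k"
    using lam mult_right_mono[of 1 lam "real k"] by simp
  have "t \<le> k \<Longrightarrow> (\<integral>\<omega>. exp (- \<theta> * potential t (c t) \<kappa> \<omega>) \<partial>M) \<le>
      exp (real t * (6 * \<theta>\<^sup>2 * W / (?n - real k))) * exp (- \<theta> * (real k / ?n * (1 - \<kappa>) * W))" for t
  proof (induction t)
    case 0
    have "(\<integral>\<omega>. exp (- \<theta> * potential 0 (c 0) \<kappa> \<omega>) \<partial>M) = (\<integral>\<omega>. exp (- \<theta> * (real k / ?n * (1 - \<kappa>) * W)) \<partial>M)"
    proof (intro Bochner_Integration.integral_cong refl)
      fix \<omega> assume \<omega>: "\<omega> \<in> space M"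
      have "gain 0 \<omega> = 0" "rest_p 1 \<omega> = W" "rest_x 1 \<omega> = W"
        using X_init p_init \<omega> by (auto simp: gain_def rest_p_def rest_x_def W_def unselected_def)
      then show "exp (- \<theta> * potential 0 (c 0) \<kappa> \<omega>) = exp (- \<theta> * (real k / ?n * (1 - \<kappa>) * W))"
        by (simp add: potential_def c_def algebra_simps)
    qed
    then show ?case by (simp add: prob_space)
  next
    case (Suc t)
    let ?m = "?n - real (Suc t) + 1"
    have t: "Suc t \<in> {1..card U}" using Suc k by auto
    have nt: "?n - real (Suc t) > 0" using Suc k by auto
    have c0: "0 \<le> c (Suc t)" using Suc nt by (simp add: c_def)
    have "(real k - real (Suc t)) * ?n \<le> real k * (?n - real (Suc t))"
      using mult_right_mono[of "real k" ?n "1 + real t"] n by (simp add: algebra_simps)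
    \<comment> \<open>The coefficients never exceed \<open>c 0 = k / n\<close>. This explains the
      choice of \<open>\<kappa>\<close>: it is the least value with
      \<open>lam * c t \<le> \<kappa>\<close> at all times, including 0.\<close>
    then have ck: "c (Suc t) \<le> real k / ?n"
      using nt n by (simp add: c_def field_simps)
    have "real k / ?n \<le> 1/2"
      using kn lamk n by (simp add: field_simps)
    with ck have "c (Suc t) \<le> 1/2" by linarith
    moreover have l: "lam * c (Suc t) \<le> \<kappa>"
      using mult_left_mono[OF ck, of lam] lam by (simp add: \<kappa>)
    moreover have "c (Suc t) * (lam + 1) \<le> 1"
      using calculation \<kappa>(2) by (simp add: algebra_simps)
    ultimately have "(\<integral>\<omega>. exp (- \<theta> * potential (Suc t) (c (Suc t)) \<kappa> \<omega>) \<partial>M) \<le>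
      exp (6 * \<theta>\<^sup>2 * W / ?m) *
        (\<integral>\<omega>. exp (- \<theta> * potential (Suc t - 1) (c (Suc t) + (1 - c (Suc t)) / ?m) \<kappa> \<omega>) \<partial>M)"
      unfolding W_def using c0 \<theta> \<kappa>0 \<kappa>(2) t by (intro integral_exp_potential_step) auto
    also have "c (Suc t) + (1 - c (Suc t)) / ?m = c t"
      using nt by (simp add: c_def divide_simps) (simp add: algebra_simps)
    \<comment> \<open>The number of remaining elements is \<open>n - t\<close>, which is at least
      \<open>n - k\<close> throughout; a uniform rate suffices.\<close>
    also have "exp (6 * \<theta>\<^sup>2 * W / ?m) \<le> exp (6 * \<theta>\<^sup>2 * W / (?n - real k))"
      using W Suc n nt by (simp add: divide_left_mono)
    also have "(\<integral>\<omega>. exp (- \<theta> * potential (Suc t - 1) (c t) \<kappa> \<omega>) \<partial>M) \<le>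
        exp (real t * (6 * \<theta>\<^sup>2 * W / (?n - real k))) * exp (- \<theta> * (real k / ?n * (1 - \<kappa>) * W))"
      using Suc by simp
    finally show ?case
      by (simp add: mult_left_mono mult_right_mono algebra_simps add_divide_distrib flip: exp_add)
  qed
  from this[of k] have "(\<integral>\<omega>. exp (- \<theta> * gain k \<omega>) \<partial>M) \<le>
      exp (real k * (6 * \<theta>\<^sup>2 * W / (?n - real k)) - \<theta> * (real k / ?n * (1 - \<kappa>) * W))"
    by (simp add: potential_def c_def flip: exp_add)
  also have "\<dots> \<le> exp (6 * \<theta>\<^sup>2 * W / lam - \<theta> * (real k / real (card U) * (1 - \<kappa>) * W))"
  proof -
    \<comment> \<open>The total loss has the factor \<open>k / (n - k)\<close>; by
      \<open>\<kappa> \<le> 1/2\<close> and \<open>lam \<ge> 1\<close> it is at most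
      \<open>1 / lam\<close>.\<close>
    have "lam * real k \<le> ?n - real k"
      using kn lamk by simp
    then have "real k / (?n - real k) \<le> 1 / lam"
      using n lam by (simp add: field_simps)
    from mult_left_mono[OF this, of "6 * \<theta>\<^sup>2 * W"] show ?thesis
      using W by (simp add: ac_simps)
  qed
  finally show ?thesis .
qed

end

end

section \<open>Choice of the parameters and Markov's inequality\<close>

theorem theorem17:
  fixes M :: "'w measure" and F :: "nat \<Rightarrow> 'w measure" and U :: "'e set"
    and x :: "'e \<Rightarrow> real" and \<sigma> :: "nat \<Rightarrow> 'w \<Rightarrow> 'e" and R :: "'w \<Rightarrow> 'e set"
    and X p \<Delta> :: "nat \<Rightarrow> 'e \<Rightarrow> 'w \<Rightarrow> real"
    and lam \<delta> :: real and a :: "'e \<Rightarrow> real"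
  assumes "lam \<ge> 1"
    and "strongly_bounded_sequential_selection_process M F U x \<sigma> R X p \<Delta> lam"
    and "\<And>e. e \<in> U \<Longrightarrow> a e \<in> {0..1}"
    and "\<delta> \<in> {0<..<1/5}"
  shows "\<P>(\<omega> in M. (\<Sum>e\<in>U. a e * X (card U) e \<omega>)
              \<le> (1/5 - \<delta>) * ((\<Sum>e\<in>U. a e * x e) / (lam + 1)))
         \<le> 4 * exp (- (\<delta>\<^sup>2 * (\<Sum>e\<in>U. a e * x e) / (3 * (lam + 1)^3)))"
proof -
  interpret strongly_bounded_sequential_selection_process M F U x \<sigma> R X p \<Delta> lam
    by fact
  note a = assms(3)
  let ?n = "real (card U)"
  define W where "W = (\<Sum>e\<in>U. a e * x e)"
  define T where "T = (1/5 - \<delta>) * (W / (lam + 1))"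
  define E where "E = \<delta>\<^sup>2 * W / (3 * (lam + 1)^3)"
  have W: "0 \<le> W"
    unfolding W_def using a x_range by (intro sum_nonneg mult_nonneg_nonneg) auto
  have "a e * x e \<le> 1" if "e \<in> U" for e
    using a[OF that] x_range[OF that] by (intro mult_le_one) auto
  then have Wn: "W \<le> ?n"
    unfolding W_def using sum_bounded_above[of U "\<lambda>e. a e * x e" 1] by simp
  have \<delta>: "0 < \<delta>" "\<delta> < 1/5" using assms(4) by auto
  have "\<P>(\<omega> in M. gain a (card U) \<omega> \<le> T) \<le> 4 * exp (- E)"
  proof (cases "E \<le> 1")
    case True
    \<comment> \<open>For \<open>E \<le> 1\<close> the claimed bound is at least 4/e, hence
      trivial.\<close>
    have "1 \<le> 4 * exp (- 1 :: real)"
      using exp_le by (simp add: exp_minus field_simps)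
    also have "\<dots> \<le> 4 * exp (- E)"
      using True by simp
    finally show ?thesis
      using prob_le_1 by (rule order_trans[rotated])
  next
    case False
    have lam: "lam \<ge> 1" by fact
    \<comment> \<open>In the remaining case \<open>E > 1\<close> together with
      \<open>W \<le> n\<close> and \<delta> < 1/5 makes \<open>n\<close> large compared with
      \<open>lam\<close>.\<close>
    have "3 * (lam + 1) \<le> 3 * (lam + 1)^3"
      using power_increasing[of 1 3 "lam + 1"] lam by simp
    also have "3 * (lam + 1)^3 < \<delta>\<^sup>2 * W"
      using False lam by (simp add: E_def field_simps)
    also have "\<delta>\<^sup>2 * W \<le> (1/5)\<^sup>2 * ?n"
      using \<delta> W Wn by (intro mult_mono power_mono) auto
    finally have "3 * (lam + 1) \<le> (1/5)\<^sup>2 * ?n" by simp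
    then have n: "75 * lam \<le> ?n" by (simp add: power2_eq_square)
    \<comment> \<open>The starting value \<open>k / n * (1 - \<kappa>)\<close> equals
      \<open>\<kappa> * (1 - \<kappa>) / lam\<close>, which is largest at \<kappa> = 1/2; rounding
      down keeps \<kappa> \<le> 1/2.\<close>
    define k where "k = nat \<lfloor>?n / (2 * lam)\<rfloor>"
    define \<kappa> where "\<kappa> = lam * (real k / ?n)"
    \<comment> \<open>The minimiser of \<open>6 * \<theta>\<^sup>2 - \<theta> * \<delta>\<close>,
      with minimum \<open>- \<delta>\<^sup>2 / 24\<close>.\<close>
    define \<theta> where "\<theta> = \<delta> / 12"
    have n0: "?n > 0" using n lam by linarith
    have k: "real k \<le> ?n / (2 * lam)" "?n / (2 * lam) < real k + 1"
      using n0 lam by (auto simp: k_def of_nat_nat le_nat_floor)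
    have \<kappa>_le: "\<kappa> \<le> 1/2"
      using k(1) n0 lam by (simp add: \<kappa>_def field_simps)
    have "?n / 2 - lam \<le> lam * real k"
      using k(2) lam by (simp add: field_simps)
    from divide_right_mono[OF this, of ?n] have "\<kappa> \<ge> 1/2 - lam / ?n"
      using n0 by (simp add: \<kappa>_def diff_divide_distrib)
    moreover have "lam / ?n \<le> 1/75"
      using n n0 by (simp add: field_simps)
    ultimately have \<kappa>_ge: "\<kappa> \<ge> 2/5" by simp
    \<comment> \<open>Source of the constant 1/5: without rounding the product would be 1/4, and the
      gap absorbs the rounding of \<open>k\<close>.\<close>
    have "2/5 * (1/2) \<le> \<kappa> * (1 - \<kappa>)"
      using \<kappa>_le \<kappa>_ge by (intro mult_mono) auto
    then have "W / (5 * lam) \<le> real k / ?n * (1 - \<kappa>) * W"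
      using lam W mult_right_mono[of "1/5" "\<kappa> * (1 - \<kappa>)" "W / lam"] by (simp add: \<kappa>_def)
    moreover have "T \<le> (1/5 - \<delta>) * (W / lam)"
      unfolding T_def using \<delta> W lam by (intro mult_left_mono divide_left_mono) auto
    ultimately have "T - real k / ?n * (1 - \<kappa>) * W \<le> - \<delta> * W / lam"
      by (simp add: algebra_simps)
    then have "\<theta> * (T - real k / ?n * (1 - \<kappa>) * W) \<le> \<theta> * (- \<delta> * W / lam)"
      using \<delta> by (intro mult_left_mono) (auto simp: \<theta>_def)
    then have "6 * \<theta>\<^sup>2 * W / lam - \<theta> * (real k / ?n * (1 - \<kappa>) * W) + \<theta> * T \<le>
        6 * \<theta>\<^sup>2 * W / lam + \<theta> * (- \<delta> * W / lam)"
      by (simp add: algebra_simps)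
    also have "\<dots> = - (\<delta>\<^sup>2 * W / (24 * lam))"
      using lam by (simp add: \<theta>_def power2_eq_square field_simps)
    also have "\<dots> \<le> - E"
    proof -
      \<comment> \<open>Combines \<open>4 * lam \<le> (lam + 1)\<^sup>2\<close> with
        \<open>2 \<le> lam + 1\<close>.\<close>
      have "4 * lam * 2 \<le> (lam + 1)\<^sup>2 * (lam + 1)"
        using lam sum_squares_ge_zero[of "lam - 1" 0]
        by (intro mult_mono) (auto simp: power2_eq_square algebra_simps)
      then have "24 * lam \<le> 3 * (lam + 1)^3"
        by (simp add: power3_eq_cube power2_eq_square)
      then show ?thesis
        unfolding E_def using lam W by (simp add: divide_left_mono)
    qed
    finally have exponent:
      "6 * \<theta>\<^sup>2 * W / lam - \<theta> * (real k / ?n * (1 - \<kappa>) * W) + \<theta> * T \<le> - E" .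
    have "real k < ?n"
      using k(1) n0 lam by (smt (verit) divide_less_eq_1_pos frac_less2 less_divide_eq_1 div_by_1)
    then have kn: "k < card U" by simp
    have \<theta>: "0 \<le> \<theta>" "\<theta> \<le> 1/3" "0 < \<theta>" using \<delta> by (auto simp: \<theta>_def)
    have gM: "gain a t \<in> borel_measurable M" if "t \<le> card U" for t
      using measurable_F_M[OF gain_measurable[OF a that]] .
    \<comment> \<open>The gain is monotone in time, so a small final gain forces a small gain at
      time \<open>k\<close>, to which the exponential Markov bound applies.\<close>
    have "\<P>(\<omega> in M. gain a (card U) \<omega> \<le> T) \<le> \<P>(\<omega> in M. exp (- \<theta> * T) \<le> exp (- \<theta> * gain a k \<omega>))"
    proof (rule finite_measure_mono)
      show "{\<omega> \<in> space M. gain a (card U) \<omega> \<le> T} \<subseteq>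
          {\<omega> \<in> space M. exp (- \<theta> * T) \<le> exp (- \<theta> * gain a k \<omega>)}"
        using gain_mono[of a k "card U", OF a] kn \<theta> by (auto intro: order_trans mult_left_mono)
      show "{\<omega> \<in> space M. exp (- \<theta> * T) \<le> exp (- \<theta> * gain a k \<omega>)} \<in> sets M"
        using gM[of k] kn by simp
    qed
    also have "\<dots> \<le> (\<integral>\<omega>. exp (- \<theta> * gain a k \<omega>) \<partial>M) / exp (- \<theta> * T)"
    proof (rule integral_Markov_inequality_measure[where A = "space M"])
      have "exp (- \<theta> * gain a k \<omega>) \<le> 1" if "\<omega> \<in> space M" for \<omega>
        using gain_nonneg[of a, OF a _ that, of k] kn \<theta> by auto
      then show "integrable M (\<lambda>\<omega>. exp (- \<theta> * gain a k \<omega>))"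
        using gM[of k] kn by (intro integrable_const_bound[of _ 1]) auto
    qed auto
    also have "\<dots> \<le> exp (6 * \<theta>\<^sup>2 * W / lam - \<theta> * (real k / ?n * (1 - \<kappa>) * W)) / exp (- \<theta> * T)"
      unfolding W_def using integral_exp_gain_le[OF a kn lam \<theta>(1,2) \<kappa>_def \<kappa>_le]
      by (intro divide_right_mono) auto
    also have "\<dots> = exp (6 * \<theta>\<^sup>2 * W / lam - \<theta> * (real k / ?n * (1 - \<kappa>) * W) + \<theta> * T)"
      by (simp add: exp_add exp_diff exp_minus divide_inverse)
    also have "\<dots> \<le> exp (- E)"
      using exponent by simp
    also have "\<dots> \<le> 4 * exp (- E)" by simp
    finally show ?thesis .
  qed
  then show ?thesis
    by (simp add: gain_def[OF a] W_def T_def E_def)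
qed

end
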